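(* Let $X\in\mathbb R^{n\times p}$ be deterministic with rank $r$ and nonzero singular values $s_1\ge\cdots\ge s_r>0$. Let $\beta\sim N(0,\tau^2I_p)$ and $Y\mid\beta\sim N(X\beta,\sigma^2I_n)$, with $\sigma,\tau>0$, and set $\lambda=\tau^2/\sigma^2$. Then \[ I(\beta;Y)=\frac12\log\det(I_p+\lambda X^\top X)=\frac12\sum_{j=1}^r\log(1+\lambda s_j^2), \] and consequently \[ d_{\rm eff}(n)=\frac1{\log n}\sum_{j=1}^r\log(1+\lambda s_j^2). \]
   Context: $I(U;V)=\mathrm{KL}(P_{U,V}\,\|\,P_U\otimes P_V)$ is mutual information (natural logarithm). The Bayesian effective dimension is $d_{\rm eff}(n)=2I(\beta;Y)/\log n$, defined for $n\ge3$. *)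

theory Defs
  imports "HOL-Probability.Probability"
begin

text \<open>
  The library's \<^const>\<open>KL_divergence\<close> is a Bochner integral and hence real-valued; it
  represents the divergence only if the integral is finite. The other cases are
  set to \<open>\<infinity>\<close> here: for probability measures with \<open>Q\<close> absolutely continuous w.r.t. \<open>P\<close> the negative part
  of \<open>log (dQ/dP)\<close> is always \<open>Q\<close>-integrable, so failure of integrability means that
  the integral is \<open>+\<infinity>\<close>. The library's argument order is \<open>KL_divergence b P Q\<close>
  for \<open>KL(Q \<parallel> P)\<close>.
\<close>

definition KL :: "'a measure \<Rightarrow> 'a measure \<Rightarrow> ereal" where
  "KL Q P =
    (if absolutely_continuous P Q \<and> integrable Q (entropy_density (exp 1) P Q)
     then ereal (KL_divergence (exp 1) P Q) else \<infinity>)"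

definition mutual_info ::
  "'w measure \<Rightarrow> 'a measure \<Rightarrow> 'b measure \<Rightarrow> ('w \<Rightarrow> 'a) \<Rightarrow> ('w \<Rightarrow> 'b) \<Rightarrow> ereal" where
  "mutual_info M S T U V =
    KL (distr M (S \<Otimes>\<^sub>M T) (\<lambda>w. (U w, V w))) (distr M S U \<Otimes>\<^sub>M distr M T V)"

lemma (in prob_space) mutual_info_eq_mutual_information:
  assumes "absolutely_continuous (distr M S U \<Otimes>\<^sub>M distr M T V) (distr M (S \<Otimes>\<^sub>M T) (\<lambda>w. (U w, V w)))"
    and "integrable (distr M (S \<Otimes>\<^sub>M T) (\<lambda>w. (U w, V w)))
      (entropy_density (exp 1) (distr M S U \<Otimes>\<^sub>M distr M T V) (distr M (S \<Otimes>\<^sub>M T) (\<lambda>w. (U w, V w))))"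
  shows "mutual_info M S T U V = ereal (mutual_information (exp 1) S T U V)"
  using assms by (simp add: mutual_info_def KL_def mutual_information_def)

text \<open>The sample size \<open>n\<close> is meant to be at least 3.\<close>

definition bayes_eff_dim ::
  "'w measure \<Rightarrow> 'a measure \<Rightarrow> 'b measure \<Rightarrow> ('w \<Rightarrow> 'a) \<Rightarrow> ('w \<Rightarrow> 'b) \<Rightarrow> nat \<Rightarrow> ereal" where
  "bayes_eff_dim M S T \<beta> Y n = 2 * mutual_info M S T \<beta> Y / ereal (ln (real n))"

text \<open>The normal distribution \<open>N(\<mu>, \<Sigma>)\<close> for a positive definite covariance matrix \<open>\<Sigma>\<close>.\<close>

definition mv_normal_density :: "real^'k \<Rightarrow> real^'k^'k \<Rightarrow> real^'k \<Rightarrow> real" where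
  "mv_normal_density \<mu> \<Sigma> x =
    exp (- ((x - \<mu>) \<bullet> (matrix_inv \<Sigma> *v (x - \<mu>))) / 2) / sqrt ((2 * pi) ^ CARD('k) * det \<Sigma>)"

definition mv_normal :: "real^'k \<Rightarrow> real^'k^'k \<Rightarrow> (real^'k) measure" where
  "mv_normal \<mu> \<Sigma> = density lborel (\<lambda>x. ennreal (mv_normal_density \<mu> \<Sigma> x))"

text \<open>
  \<open>V | U \<sim> K(U)\<close>: the Markov kernel \<open>K\<close> is a regular conditional distribution of \<open>V\<close>
  given \<open>U\<close>, that is, \<open>P(V \<in> B | \<sigma>(U)) = K(U)(B)\<close> almost surely for every \<open>B\<close>.
\<close>

definition has_cond_distr ::
  "'w measure \<Rightarrow> 'a measure \<Rightarrow> 'b measure \<Rightarrow> ('w \<Rightarrow> 'a) \<Rightarrow> ('w \<Rightarrow> 'b) \<Rightarrow> ('a \<Rightarrow> 'b measure) \<Rightarrow> bool"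
where
  "has_cond_distr M S T U V K \<longleftrightarrow>
    K \<in> S \<rightarrow>\<^sub>M prob_algebra T \<and>
    (\<forall>B\<in>sets T. AE w in M.
      real_cond_exp M (vimage_algebra (space M) U S) (indicator (V -` B \<inter> space M)) w
        = measure (K (U w)) B)"

text \<open>
  \<open>s 1 \<ge> \<dots> \<ge> s r > 0\<close> are the nonzero singular values of \<open>X\<close>, the positive square
  roots of the eigenvalues of \<open>X\<^sup>T X\<close>, each listed according to its multiplicity. Since
  \<open>X\<^sup>T X\<close> is symmetric, the multiplicity is the dimension of the eigenspace; for \<open>t > 0\<close>
  not a singular value that dimension is 0.
\<close>

definition nonzero_singular_values :: "real^'p^'n \<Rightarrow> nat \<Rightarrow> (nat \<Rightarrow> real) \<Rightarrow> bool" where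
  "nonzero_singular_values X r s \<longleftrightarrow>
    antimono_on {1..r} s \<and>
    (\<forall>j\<in>{1..r}. s j > 0) \<and>
    (\<forall>t>0. card {j\<in>{1..r}. s j = t} = dim {v. (transpose X ** X) *v v = t\<^sup>2 *\<^sub>R v})"

end

theory Submission
  imports Defs
begin

text \<open>
  Write \<open>A = \<tau>\<^bsup>-2\<^esup> I + \<sigma>\<^bsup>-2\<^esup> X\<^sup>T X\<close>. Completing the square in \<open>\<beta>\<close> factorises the joint density as the
  marginal density \<open>h\<close> of \<open>Y\<close> times a normal density for \<open>\<beta>\<close> with precision matrix \<open>A\<close> and mean \<open>w(Y)\<close>.
  Comparing normalising constants gives the factor \<open>det(I + \<lambda> X\<^sup>T X)\<close>, and the log density ratio is
  \<open>1/2 log det(I + \<lambda> X\<^sup>T X) + \<bar>\<beta>\<bar>\<^sup>2/(2 \<tau>\<^sup>2) - (\<beta> - w(Y))\<^sup>T A (\<beta> - w(Y))/2\<close>. The two quadratic forms both have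
  expectation \<open>p/2\<close>, so they cancel, and neither the covariance matrix of \<open>Y\<close> nor its inverse is needed.
  An orthonormal eigenbasis of \<open>X\<^sup>T X\<close> turns the determinant into the product over the singular values.
\<close>

section \<open>Spectral theorem for real symmetric matrices\<close>

lemma symmetric_matrix_inner:
  fixes S :: "real^'n^'n"
  assumes "transpose S = S"
  shows "x \<bullet> (S *v y) = (S *v x) \<bullet> y"
  by (metis assms dot_lmul_matrix transpose_matrix_vector)

text \<open>Compactness provides a maximiser \<open>u\<close> of the quadratic form
  \<open>x \<bullet> (S *v x)\<close> on the unit sphere of \<open>W\<close>, and such a maximiser
  is an eigenvector whose eigenvalue is the maximum. The version relative to an invariant subspace
  allows eigenvectors to be split off one after another.\<close>

lemma symmetric_matrix_eigenvector:
  fixes S :: "real^'n^'n"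
  assumes sym: "transpose S = S" and W: "subspace W" "W \<noteq> {0}"
    and inv: "\<And>x. x \<in> W \<Longrightarrow> S *v x \<in> W"
  obtains u c where "u \<in> W" "norm u = 1" "S *v u = c *\<^sub>R u"
proof -
  obtain x0 where x0: "x0 \<in> W" "x0 \<noteq> 0"
    using W subspace_0 by blast
  let ?K = "W \<inter> sphere 0 1"
  have "compact ?K"
    using closed_subspace[OF W(1)] by (simp add: closed_Int_compact)
  moreover have "(1 / norm x0) *\<^sub>R x0 \<in> ?K"
    using x0 W(1) by (auto simp: subspace_scale)
  then have "?K \<noteq> {}" by blast
  moreover have "continuous_on ?K (\<lambda>x. x \<bullet> (S *v x))"
    by (intro continuous_intros)
  ultimately obtain u where u: "u \<in> ?K" and max: "\<And>x. x \<in> ?K \<Longrightarrow> x \<bullet> (S *v x) \<le> u \<bullet> (S *v u)"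
    using continuous_attains_sup[of ?K "\<lambda>x. x \<bullet> (S *v x)"] by blast
  define c where "c = u \<bullet> (S *v u)"
  \<comment> \<open>By maximality of \<open>c\<close>, the map \<open>T = c I - S\<close> is
    positive semidefinite on \<open>W\<close>, and its quadratic form vanishes at \<open>u\<close>.
    The rest of the proof shows that this forces \<open>T u = 0\<close>.\<close>
  define T where "T x = c *\<^sub>R x - S *v x" for x
  have linT: "T (x + t *\<^sub>R y) = T x + t *\<^sub>R T y" for x y t
    by (simp add: T_def matrix_vector_right_distrib algebra_simps matrix_vector_mult_scaleR)
  have symT: "x \<bullet> T y = T x \<bullet> y" for x y
    by (simp add: T_def inner_diff_left inner_diff_right symmetric_matrix_inner[OF sym])
  have TW: "T x \<in> W" if "x \<in> W" for x
    unfolding T_def using that W(1) inv by (simp add: subspace_diff subspace_scale)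
  have uu: "u \<bullet> u = 1" "u \<in> W"
    using u by (auto simp: norm_eq_1)
  have psd: "0 \<le> x \<bullet> T x" if "x \<in> W" for x
  proof (cases "x = 0")
    case False
    let ?y = "(1 / norm x) *\<^sub>R x"
    have "?y \<in> ?K" using that False W(1) by (auto simp: subspace_scale)
    then have "?y \<bullet> (S *v ?y) \<le> c" unfolding c_def by (rule max)
    also have "?y \<bullet> (S *v ?y) = (x \<bullet> (S *v x)) / (norm x)\<^sup>2"
      by (simp add: matrix_vector_mult_scaleR power2_eq_square)
    finally have "x \<bullet> (S *v x) \<le> c * (norm x)\<^sup>2"
      using False by (simp add: divide_le_eq)
    then show ?thesis
      by (simp add: T_def inner_diff_right power2_norm_eq_inner)
  qed (simp add: T_def)
  have "u \<bullet> T u = 0" by (simp add: T_def inner_diff_right uu c_def)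
  \<comment> \<open>The nonnegative quadratic \<open>t \<mapsto> (u + t v) \<bullet> T (u + t v)\<close> vanishes at 0, so its linear
    coefficient is 0; take \<open>v = T u\<close>.\<close>
  have quad: "0 \<le> 2 * t * (T u \<bullet> T u) + t\<^sup>2 * (T u \<bullet> T (T u))" for t
  proof -
    have "0 \<le> (u + t *\<^sub>R T u) \<bullet> T (u + t *\<^sub>R T u)"
      using uu(2) TW W(1) by (intro psd) (simp add: subspace_add subspace_scale)
    also have "\<dots> = 2 * t * (T u \<bullet> T u) + t\<^sup>2 * (T u \<bullet> T (T u))"
      using \<open>u \<bullet> T u = 0\<close>
      by (simp add: linT inner_add_left inner_add_right power2_eq_square symT algebra_simps)
    finally show ?thesis .
  qed
  have "T u = 0"
  proof (rule ccontr)
    assume "T u \<noteq> 0"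
    define q where "q = T u \<bullet> T u"
    define s where "s = T u \<bullet> T (T u)"
    have q: "q > 0" using \<open>T u \<noteq> 0\<close> by (simp add: q_def)
    have s: "s \<ge> 0" unfolding s_def using psd TW uu(2) by blast
    \<comment> \<open>At \<open>t = - a\<close> the quadratic \<open>2 t q + t^2 s\<close> equals
      \<open>- a^2 (s + 2)\<close>, which contradicts its nonnegativity. The \<open>+ 1\<close>
      keeps the denominator positive when \<open>s = 0\<close>.\<close>
    define a where "a = q / (s + 1)"
    have a: "a > 0" "q = a * (s + 1)" using q s by (auto simp: a_def)
    have "0 \<le> 2 * (- a) * q + (- a)\<^sup>2 * s"
      using quad[of "- a"] by (simp add: q_def s_def)
    also have "\<dots> = - (a\<^sup>2 * (s + 2))"
      by (simp add: a(2) power2_eq_square algebra_simps)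
    also have "\<dots> < 0"
      using a s by simp
    finally show False by simp
  qed
  then have "S *v u = c *\<^sub>R u" by (simp add: T_def)
  with uu u show ?thesis using that by auto
qed

text \<open>An orthonormal set of eigenvectors of greatest cardinality spans the space: otherwise
  its orthogonal complement is nonzero, invariant because \<open>S\<close> is symmetric, and
  contains a further unit eigenvector. Indexing the basis by \<open>'n\<close> itself lets it serve
  as the columns of a square matrix.\<close>

theorem symmetric_matrix_eigenbasis:
  fixes S :: "real^'n^'n"
  assumes sym: "transpose S = S"
  obtains v :: "'n \<Rightarrow> real^'n" and d :: "'n \<Rightarrow> real"
    where "\<And>i j. v i \<bullet> v j = (if i = j then 1 else 0)" "\<And>i. S *v v i = d i *\<^sub>R v i"
proof -
  define P where "P B \<longleftrightarrow> pairwise orthogonal B \<and> (\<forall>b\<in>B. norm b = 1) \<and> (\<forall>b\<in>B. \<exists>c. S *v b = c *\<^sub>R b)"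
    for B
  have indep: "independent B" if "P B" for B
    using that unfolding P_def by (intro pairwise_orthogonal_independent) auto
  have bound: "card B \<le> CARD('n)" if "P B" for B
    using independent_bound_general[OF indep[OF that]] dim_subset_UNIV_cart[of B] by linarith
  have "P {}" by (simp add: P_def)
  then obtain B where PB: "P B" and Bmax: "\<And>C. P C \<Longrightarrow> card C \<le> card B"
    using ex_has_greatest_nat[of P "{}" card "Suc CARD('n)"] bound by (auto simp: less_Suc_eq_le)
  have finB: "finite B" using indep[OF PB] independent_bound_general by blast
  let ?W = "B\<^sup>\<bottom>"
  have "?W = {0}"
  proof (rule ccontr)
    assume "?W \<noteq> {0}"
    moreover have "S *v x \<in> ?W" if x: "x \<in> ?W" for x
      unfolding orthogonal_comp_def mem_Collect_eq
    proof
      fix b assume b: "b \<in> B"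
      then obtain c where "S *v b = c *\<^sub>R b" using PB unfolding P_def by blast
      then show "orthogonal b (S *v x)"
        using x b by (simp add: orthogonal_def symmetric_matrix_inner[OF sym] orthogonal_comp_def)
    qed
    ultimately obtain u c where u: "u \<in> ?W" "norm u = 1" "S *v u = c *\<^sub>R u"
      using symmetric_matrix_eigenvector[OF sym subspace_orthogonal_comp] by metis
    have uB: "u \<notin> B"
      using u(1,2) by (auto simp: orthogonal_comp_def orthogonal_def norm_eq_1)
    have "P (insert u B)"
      using PB u unfolding P_def
      by (auto simp: pairwise_insert orthogonal_comp_def orthogonal_commute)
    from Bmax[OF this] show False using finB uB by simp
  qed
  moreover have "(span B)\<^sup>\<bottom> \<subseteq> ?W"
    by (intro orthogonal_comp_anti_mono span_superset)
  ultimately have "(span B)\<^sup>\<bottom> = {0}"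
    using subspace_0[OF subspace_orthogonal_comp[of "span B"]] by blast
  then have "span B = UNIV"
    using orthogonal_comp_self[of "span B"] by simp
  then have "card B = CARD('n)"
    using indep[OF PB] by (metis dim_UNIV indep_card_eq_dim_span DIM_cart DIM_real mult.right_neutral)
  then obtain v where v: "bij_betw v (UNIV :: 'n set) B"
    using finB by (metis finite_same_card_bij finite_class.finite_UNIV)
  have "\<exists>c. S *v v i = c *\<^sub>R v i" for i
    using PB bij_betwE[OF v] by (auto simp: P_def)
  then obtain d where "\<And>i. S *v v i = d i *\<^sub>R v i" by metis
  moreover have "v i \<bullet> v j = (if i = j then 1 else 0)" for i j
  proof -
    have "v i \<in> B" "v j \<in> B" using v by (auto dest: bij_betwE)
    moreover have "v i = v j \<longleftrightarrow> i = j" using v by (auto simp: bij_betw_def inj_on_def)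
    ultimately show ?thesis
      using PB unfolding P_def pairwise_def orthogonal_def norm_eq_1 by metis
  qed
  ultimately show ?thesis using that by blast
qed

section \<open>Coordinates, determinants and eigenspaces in an orthonormal basis\<close>

lemma sum_mult_delta:
  fixes f :: "'n::finite \<Rightarrow> real"
  shows "(\<Sum>i\<in>UNIV. f i * (if j = i then 1 else 0)) = f j"
proof -
  have "(\<Sum>i\<in>UNIV. f i * (if j = i then 1 else 0)) = (\<Sum>i\<in>UNIV. if j = i then f i else 0)"
    by (intro sum.cong) auto
  then show ?thesis by simp
qed

lemma orthonormal_family:
  fixes v :: "'i \<Rightarrow> 'a::euclidean_space"
  assumes on: "\<And>i j. v i \<bullet> v j = (if i = j then 1 else 0)"
  shows "inj v" and "independent (v ` I)"
proof -
  show inj: "inj v"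
  proof (rule injI)
    fix i j assume "v i = v j"
    then have "v i \<bullet> v j = 1" using on[of j j] by simp
    then show "i = j" by (simp add: on split: if_splits)
  qed
  have "pairwise orthogonal (v ` I)"
    unfolding pairwise_def orthogonal_def
  proof (intro ballI impI)
    fix a b assume "a \<in> v ` I" "b \<in> v ` I" "a \<noteq> b"
    then show "a \<bullet> b = 0" by (auto simp: on)
  qed
  moreover have "0 \<notin> v ` I"
  proof
    assume "0 \<in> v ` I"
    then obtain i where "v i = 0" by auto
    then show False using on[of i i] by simp
  qed
  ultimately show "independent (v ` I)" by (rule pairwise_orthogonal_independent)
qed

text \<open>Independence and the count \<open>CARD('n)\<close> make the family span the space. The
  remainder \<open>w\<close> of the expansion is orthogonal to every \<open>v j\<close>, hence to
  itself.\<close>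

lemma orthonormal_expansion:
  fixes v :: "'n \<Rightarrow> real^'n"
  assumes on: "\<And>i j. v i \<bullet> v j = (if i = j then 1 else 0)"
  shows "x = (\<Sum>i\<in>UNIV. (v i \<bullet> x) *\<^sub>R v i)"
    and "x \<bullet> y = (\<Sum>i\<in>UNIV. (v i \<bullet> x) * (v i \<bullet> y))"
proof -
  have "card (range v) = CARD('n)"
    using orthonormal_family(1)[OF on] by (simp add: card_image)
  then have "UNIV \<subseteq> span (range v)"
    using orthonormal_family(2)[OF on] by (intro card_ge_dim_independent) auto
  then have sp: "z \<in> span (range v)" for z by auto
  define w where "w = x - (\<Sum>i\<in>UNIV. (v i \<bullet> x) *\<^sub>R v i)"
  have "v j \<bullet> w = 0" for j
  proof -
    have "v j \<bullet> w = v j \<bullet> x - (\<Sum>i\<in>UNIV. (v i \<bullet> x) * (if j = i then 1 else 0))"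
      by (simp only: w_def inner_diff_right inner_sum_right inner_scaleR_right on)
    also have "\<dots> = 0" by (simp only: sum_mult_delta diff_self)
    finally show ?thesis .
  qed
  then have "orthogonal w w"
    by - (rule orthogonal_to_span[OF sp], auto simp: orthogonal_def inner_commute)
  then have "w = 0" by (simp add: orthogonal_def)
  then show exp: "x = (\<Sum>i\<in>UNIV. (v i \<bullet> x) *\<^sub>R v i)"
    unfolding w_def by (rule iffD1[OF right_minus_eq])
  have "x \<bullet> y = (\<Sum>i\<in>UNIV. (v i \<bullet> x) *\<^sub>R v i) \<bullet> y" using exp by (rule arg_cong)
  then show "x \<bullet> y = (\<Sum>i\<in>UNIV. (v i \<bullet> x) * (v i \<bullet> y))"
    by (simp add: inner_sum_left)
qed

text \<open>With the eigenvectors as columns of \<open>P\<close>, the eigenvalue equations read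
  \<open>S ** P = P ** D\<close> with \<open>D\<close> diagonal; orthonormality makes
  \<open>det P\<close> nonzero, so it cancels.\<close>

lemma det_eigenbasis:
  fixes S :: "real^'n^'n" and v :: "'n \<Rightarrow> real^'n"
  assumes on: "\<And>i j. v i \<bullet> v j = (if i = j then 1 else 0)"
    and ev: "\<And>i. S *v v i = d i *\<^sub>R v i"
  shows "det S = (\<Prod>i\<in>UNIV. d i)"
proof -
  define P :: "real^'n^'n" where "P = (\<chi> i j. v j $ i)"
  define D :: "real^'n^'n" where "D = (\<chi> i j. if i = j then d i else 0)"
  have "transpose P ** P = mat 1"
    using on by (simp add: vec_eq_iff matrix_matrix_mult_def transpose_def P_def mat_def inner_vec_def)
  then have "det P * det P = 1"
    by (metis det_mul det_transpose det_I)
  then have P0: "det P \<noteq> 0" by auto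
  have "S ** P = P ** D"
  proof -
    have "(S ** P) $ i $ j = (P ** D) $ i $ j" for i j
    proof -
      have "(S ** P) $ i $ j = (S *v v j) $ i"
        by (simp add: matrix_matrix_mult_def matrix_vector_mult_def P_def)
      also have "\<dots> = (P ** D) $ i $ j"
        by (simp add: ev matrix_matrix_mult_def P_def D_def if_distrib mult.commute cong: if_cong)
      finally show ?thesis .
    qed
    then show ?thesis by (simp add: vec_eq_iff)
  qed
  then have "det S * det P = det P * det D" by (metis det_mul)
  then have "det S = det D" using P0 by simp
  also have "\<dots> = (\<Prod>i\<in>UNIV. d i)"
    by (subst det_diagonal) (auto simp: D_def)
  finally show ?thesis .
qed

text \<open>Comparing coordinates in \<open>S *v x = c *\<^sub>R x\<close> kills every coordinate of
  \<open>x\<close> with \<open>d i \<noteq> c\<close>, so the remaining \<open>v i\<close> span the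
  eigenspace. This translates the multiplicity in \<open>nonzero_singular_values\<close>, a
  dimension, into a number of indices.\<close>

lemma dim_eigenspace_eigenbasis:
  fixes S :: "real^'n^'n" and v :: "'n \<Rightarrow> real^'n"
  assumes on: "\<And>i j. v i \<bullet> v j = (if i = j then 1 else 0)"
    and ev: "\<And>i. S *v v i = d i *\<^sub>R v i"
  shows "dim {x. S *v x = c *\<^sub>R x} = card {i. d i = c}"
proof -
  let ?I = "{i. d i = c}"
  have "{x. S *v x = c *\<^sub>R x} = span (v ` ?I)"
  proof (rule subset_antisym)
    show "{x. S *v x = c *\<^sub>R x} \<subseteq> span (v ` ?I)"
    proof
      fix x assume "x \<in> {x. S *v x = c *\<^sub>R x}"
      then have x: "S *v x = c *\<^sub>R x" by simp
      have "v i \<bullet> x = 0" if "d i \<noteq> c" for i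
      proof -
        have "S *v x = S *v (\<Sum>j\<in>UNIV. (v j \<bullet> x) *\<^sub>R v j)"
          using orthonormal_expansion(1)[OF on] by (rule arg_cong)
        also have "\<dots> = (\<Sum>j\<in>UNIV. (v j \<bullet> x) *\<^sub>R (d j *\<^sub>R v j))"
          by (simp only: linear_sum[OF matrix_vector_mul_linear] matrix_vector_mult_scaleR ev)
        finally have "v i \<bullet> (c *\<^sub>R x) = v i \<bullet> (\<Sum>j\<in>UNIV. (v j \<bullet> x) *\<^sub>R (d j *\<^sub>R v j))"
          by (simp only: x)
        then have "c * (v i \<bullet> x) = (\<Sum>j\<in>UNIV. ((v j \<bullet> x) * d j) * (if i = j then 1 else 0))"
          by (simp only: inner_sum_right inner_scaleR_right on mult.assoc)
        also have "\<dots> = (v i \<bullet> x) * d i" by (rule sum_mult_delta)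
        finally have "c * (v i \<bullet> x) = d i * (v i \<bullet> x)" by simp
        with that show ?thesis by simp
      qed
      then have "(\<Sum>i\<in>UNIV. (v i \<bullet> x) *\<^sub>R v i) = (\<Sum>i\<in>?I. (v i \<bullet> x) *\<^sub>R v i)"
        by (intro sum.mono_neutral_right) auto
      with orthonormal_expansion(1)[OF on] have "x = (\<Sum>i\<in>?I. (v i \<bullet> x) *\<^sub>R v i)"
        by (rule trans)
      also have "\<dots> \<in> span (v ` ?I)"
        by (intro span_sum span_scale span_base) auto
      finally show "x \<in> span (v ` ?I)" .
    qed
    show "span (v ` ?I) \<subseteq> {x. S *v x = c *\<^sub>R x}"
    proof (rule span_minimal)
      show "subspace {x. S *v x = c *\<^sub>R x}"
        by (auto simp: subspace_def matrix_vector_right_distrib matrix_vector_mult_scaleR algebra_simps)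
    qed (auto simp: ev)
  qed
  then show ?thesis
    by (simp add: dim_eq_card_independent[OF orthonormal_family(2)[OF on]]
        card_image[OF inj_on_subset[OF orthonormal_family(1)[OF on]]])
qed

section \<open>The Gram matrix and the singular values\<close>

lemma transpose_gram: "transpose (transpose X ** X) = transpose X ** (X :: real^'p^'n)"
  by (simp add: matrix_transpose_mul)

lemma inner_gram:
  fixes X :: "real^'p^'n"
  shows "x \<bullet> ((transpose X ** X) *v y) = (X *v x) \<bullet> (X *v y)"
proof -
  have "x \<bullet> ((transpose X ** X) *v y) = x \<bullet> ((X *v y) v* X)"
    by (simp only: matrix_vector_mul_assoc[symmetric] transpose_matrix_vector)
  also have "\<dots> = (X *v y) \<bullet> (X *v x)"
    by (simp only: inner_commute[of x] dot_lmul_matrix)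
  finally show ?thesis by (simp only: inner_commute)
qed

lemma eigenvalue_add_scaleR:
  fixes S :: "real^'n^'n"
  assumes "S *v x = c *\<^sub>R x"
  shows "(a *\<^sub>R mat 1 + b *\<^sub>R S) *v x = (a + b * c) *\<^sub>R x"
proof -
  have "(a *\<^sub>R mat 1 + b *\<^sub>R S) *v x = a *\<^sub>R (mat 1 *v x) + b *\<^sub>R (S *v x)"
    by (simp only: matrix_vector_mult_add_rdistrib scaleR_matrix_vector_assoc)
  then show ?thesis by (simp only: assms matrix_vector_mul_lid scaleR_scaleR scaleR_add_left)
qed

text \<open>Both sides are sums of \<open>ln (1 + lam * c)\<close> over the positive eigenvalues
  \<open>c\<close> of the Gram matrix with multiplicity, one indexed by \<open>'p\<close> and the
  other by \<open>{1..r}\<close>. Grouping each sum by the value \<open>c\<close> reduces the claim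
  to equality of the multiplicities.\<close>

lemma ln_det_singular_values:
  fixes X :: "real^'p^'n"
  assumes sv: "nonzero_singular_values X r s" and lam: "lam \<ge> 0"
  shows "ln (det (mat 1 + lam *\<^sub>R (transpose X ** X))) = (\<Sum>j=1..r. ln (1 + lam * (s j)\<^sup>2))"
proof -
  let ?S = "transpose X ** X"
  obtain v :: "'p \<Rightarrow> real^'p" and d where on: "\<And>i j. v i \<bullet> v j = (if i = j then 1 else 0)"
    and ev: "\<And>i. ?S *v v i = d i *\<^sub>R v i"
    using symmetric_matrix_eigenbasis[OF transpose_gram[of X]] by blast
  have spos: "0 < (s j)\<^sup>2" if "j \<in> {1..r}" for j
    using sv bspec[OF _ that, of "\<lambda>j. 0 < s j"] by (simp add: nonzero_singular_values_def)
  \<comment> \<open>The eigenvalue \<open>d i\<close> is the squared norm of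
    \<open>X *v v i\<close>.\<close>
  have d: "d i \<ge> 0" for i
  proof -
    have "d i = v i \<bullet> (?S *v v i)" by (simp add: ev on)
    then show ?thesis by (simp only: inner_gram) simp
  qed
  \<comment> \<open>Both cardinalities are the dimension of the eigenspace for \<open>c\<close>;
    positivity of \<open>s j\<close> turns the condition on the square into
    \<open>s j = sqrt c\<close>.\<close>
  have card_eq: "card {j\<in>{1..r}. (s j)\<^sup>2 = c} = card {i. d i = c}" if "c > 0" for c
  proof -
    have "{j\<in>{1..r}. (s j)\<^sup>2 = c} = {j\<in>{1..r}. s j = sqrt c}"
      using sv that by (auto simp: nonzero_singular_values_def real_sqrt_unique less_imp_le)
    also have "card \<dots> = dim {x. ?S *v x = (sqrt c)\<^sup>2 *\<^sub>R x}"
      using sv that by (simp add: nonzero_singular_values_def)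
    also have "\<dots> = card {i. d i = c}"
      using that by (simp add: dim_eigenspace_eigenbasis[OF on ev])
    finally show ?thesis .
  qed
  have pos: "1 + lam * d i > 0" for i
    using lam d by (intro add_pos_nonneg) auto
  have "det (mat 1 + lam *\<^sub>R ?S) = (\<Prod>i\<in>UNIV. 1 + lam * d i)"
    using eigenvalue_add_scaleR[OF ev, of 1 lam] by (intro det_eigenbasis[OF on]) (simp only: scaleR_one)
  then have "ln (det (mat 1 + lam *\<^sub>R ?S)) = (\<Sum>i\<in>UNIV. ln (1 + lam * d i))"
    using pos by (simp add: ln_prod less_imp_neq[THEN not_sym])
  \<comment> \<open>The eigenvalue 0 contributes \<open>ln 1 = 0\<close>. Only positive eigenvalues
    remain, and for these \<open>card_eq\<close> is available.\<close>
  also have "\<dots> = (\<Sum>i\<in>{i. d i \<noteq> 0}. ln (1 + lam * d i))"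
    by (rule sum.mono_neutral_right) auto
  also have "\<dots> = (\<Sum>c\<in>d ` {i. d i \<noteq> 0}. real (card {i. d i = c}) * ln (1 + lam * c))"
    by (subst sum.image_gen[where g=d]) (auto intro!: sum.cong arg_cong[where f=card])
  also have "\<dots> = (\<Sum>c\<in>(\<lambda>j. (s j)\<^sup>2) ` {1..r}. real (card {i. d i = c}) * ln (1 + lam * c))"
  proof (rule sum.cong)
    show "d ` {i. d i \<noteq> 0} = (\<lambda>j. (s j)\<^sup>2) ` {1..r}"
    proof (intro set_eqI iffI)
      fix c assume "c \<in> d ` {i. d i \<noteq> 0}"
      then obtain i where i: "c = d i" "d i \<noteq> 0" by auto
      then have "c > 0" using d[of i] by simp
      moreover have "card {i. d i = c} \<noteq> 0" using i by auto
      ultimately have "{j\<in>{1..r}. (s j)\<^sup>2 = c} \<noteq> {}" using card_eq by (metis card.empty)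
      then show "c \<in> (\<lambda>j. (s j)\<^sup>2) ` {1..r}" by auto
    next
      fix c assume "c \<in> (\<lambda>j. (s j)\<^sup>2) ` {1..r}"
      then obtain j where j: "j \<in> {1..r}" "c = (s j)\<^sup>2" by auto
      then have "c > 0" using spos by fastforce
      moreover have "card {j\<in>{1..r}. (s j)\<^sup>2 = c} \<noteq> 0" using j by auto
      ultimately have "{i. d i = c} \<noteq> {}" using card_eq by (metis card.empty)
      with \<open>c > 0\<close> show "c \<in> d ` {i. d i \<noteq> 0}" by auto
    qed
  qed simp
  also have "\<dots> = (\<Sum>c\<in>(\<lambda>j. (s j)\<^sup>2) ` {1..r}. real (card {j\<in>{1..r}. (s j)\<^sup>2 = c}) * ln (1 + lam * c))"
  proof (rule sum.cong)
    fix c assume "c \<in> (\<lambda>j. (s j)\<^sup>2) ` {1..r}"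
    then have "c > 0" using spos by fastforce
    then show "real (card {i. d i = c}) * ln (1 + lam * c)
        = real (card {j\<in>{1..r}. (s j)\<^sup>2 = c}) * ln (1 + lam * c)"
      by (simp only: card_eq)
  qed simp
  also have "\<dots> = (\<Sum>j=1..r. ln (1 + lam * (s j)\<^sup>2))"
    by (subst sum.image_gen[of "{1..r}" _ "\<lambda>j. (s j)\<^sup>2"]) (auto intro!: sum.cong)
  finally show ?thesis .
qed

section \<open>Gaussian integrals\<close>

lemma nn_integral_lborel_translation:
  fixes F :: "'a::euclidean_space \<Rightarrow> ennreal"
  assumes [measurable]: "F \<in> borel_measurable borel"
  shows "(\<integral>\<^sup>+x. F (x + c) \<partial>lborel) = (\<integral>\<^sup>+x. F x \<partial>lborel)"
proof -
  have "(\<integral>\<^sup>+x. F x \<partial>lborel) = (\<integral>\<^sup>+x. F x \<partial>distr lborel borel ((+) c))"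
    by (simp only: lborel_distr_plus)
  also have "\<dots> = (\<integral>\<^sup>+x. F (x + c) \<partial>lborel)"
    by (subst nn_integral_distr) (auto simp: add.commute)
  finally show ?thesis by simp
qed

text \<open>Integrating \<open>F (T x) * indicator (ball 0 1) (y - T x)\<close> over \<open>x\<close> and \<open>y\<close> in both orders gives
  the two sides times the volume of the ball. The library's change of variables formula for linear
  maps does not apply, as it requires a wellordered index type.\<close>

lemma nn_integral_lborel_orthogonal:
  fixes T :: "'a::euclidean_space \<Rightarrow> 'a" and F :: "'a \<Rightarrow> ennreal"
  assumes T: "orthogonal_transformation T" and [measurable]: "F \<in> borel_measurable borel"
  shows "(\<integral>\<^sup>+x. F (T x) \<partial>lborel) = (\<integral>\<^sup>+x. F x \<partial>lborel)"
proof -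
  let ?D = "\<lambda>x::'a. indicator (ball 0 1) x :: ennreal"
  let ?V = "emeasure lborel (ball 0 1 :: 'a set)"
  have linT: "linear T" and normT: "norm (T x) = norm x" for x
    using T by (auto simp: orthogonal_transformation_linear orthogonal_transformation_norm)
  have [measurable]: "T \<in> borel_measurable borel"
    using linT by (intro borel_measurable_continuous_onI linear_continuous_on) (simp add: linear_conv_bounded_linear)
  have [measurable]: "?D \<in> borel_measurable borel" by (intro borel_measurable_indicator) simp
  have V: "0 < ?V" "?V < \<infinity>"
  proof -
    show "0 < ?V"
      using content_ball_pos[of 1 "0::'a"] by (auto simp: measure_def enn2real_positive_iff)
    show "?V < \<infinity>" by (rule emeasure_lborel_ball_finite)
  qed
  have D: "(\<integral>\<^sup>+y. ?D y \<partial>lborel) = ?V" by (simp add: nn_integral_indicator)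
  \<comment> \<open>A bare choice of preimages is enough: \<open>U y\<close> occurs only as a
    translation vector for a fixed \<open>y\<close>.\<close>
  obtain U where U: "T (U y) = y" for y
    using orthogonal_transformation_surj[OF T] by (metis surj_def)
  have "(\<integral>\<^sup>+x. F (T x) \<partial>lborel) * ?V = (\<integral>\<^sup>+x. \<integral>\<^sup>+y. F (T x) * ?D (y - T x) \<partial>lborel \<partial>lborel)"
  proof -
    have "(\<integral>\<^sup>+y. F (T x) * ?D (y - T x) \<partial>lborel) = F (T x) * ?V" for x
      using nn_integral_lborel_translation[of ?D "- T x"] by (simp add: nn_integral_cmult D)
    then show ?thesis by (simp add: nn_integral_multc)
  qed
  also have "\<dots> = (\<integral>\<^sup>+y. \<integral>\<^sup>+x. F (T x) * ?D (y - T x) \<partial>lborel \<partial>lborel)"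
    by (rule lborel_pair.Fubini') measurable
  \<comment> \<open>Translating \<open>x\<close> by \<open>U y\<close> replaces \<open>T x\<close>
    by \<open>T x + y\<close>. The argument of the indicator becomes \<open>- T x\<close>, which
    lies in the unit ball exactly when \<open>x\<close> does.\<close>
  also have "\<dots> = (\<integral>\<^sup>+y. \<integral>\<^sup>+x. F (T x + y) * ?D x \<partial>lborel \<partial>lborel)"
  proof (rule nn_integral_cong)
    fix y :: 'a
    have "(\<integral>\<^sup>+x. F (T x) * ?D (y - T x) \<partial>lborel) = (\<integral>\<^sup>+x. F (T (x + U y)) * ?D (y - T (x + U y)) \<partial>lborel)"
      by (rule nn_integral_lborel_translation[symmetric]) measurable
    then show "(\<integral>\<^sup>+x. F (T x) * ?D (y - T x) \<partial>lborel) = (\<integral>\<^sup>+x. F (T x + y) * ?D x \<partial>lborel)"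
      by (simp add: linear_add[OF linT] U normT indicator_def)
  qed
  also have "\<dots> = (\<integral>\<^sup>+x. \<integral>\<^sup>+y. F (T x + y) * ?D x \<partial>lborel \<partial>lborel)"
    by (rule lborel_pair.Fubini') measurable
  also have "\<dots> = (\<integral>\<^sup>+x. (\<integral>\<^sup>+y. F y \<partial>lborel) * ?D x \<partial>lborel)"
  proof (rule nn_integral_cong)
    fix x :: 'a
    show "(\<integral>\<^sup>+y. F (T x + y) * ?D x \<partial>lborel) = (\<integral>\<^sup>+y. F y \<partial>lborel) * ?D x"
      using nn_integral_lborel_translation[of F "T x"]
      by (subst nn_integral_multc) (auto simp: add.commute)
  qed
  also have "\<dots> = (\<integral>\<^sup>+y. F y \<partial>lborel) * ?V"
    by (simp add: nn_integral_cmult D)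
  finally have "(\<integral>\<^sup>+x. F (T x) \<partial>lborel) * ?V = (\<integral>\<^sup>+y. F y \<partial>lborel) * ?V" .
  then show ?thesis
    using V by (metis ennreal_mult_divide_eq infinity_ennreal_def less_irrefl)
qed

section \<open>Gaussian integrals: total mass and second moment\<close>

lemma nn_integral_gaussian_1d:
  fixes a :: real
  assumes "a > 0"
  shows "(\<integral>\<^sup>+x. ennreal (exp (- (a * x\<^sup>2) / 2)) \<partial>lborel) = ennreal (sqrt (2 * pi / a))"
    and "(\<integral>\<^sup>+x. ennreal (a * x\<^sup>2 * exp (- (a * x\<^sup>2) / 2)) \<partial>lborel) = ennreal (sqrt (2 * pi / a))"
proof -
  \<comment> \<open>\<open>c\<close> is the standard deviation for which the exponential is a
    multiple of \<open>normal_density 0 c\<close>. The second moment is \<open>1 / a\<close>, which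
    cancels the factor \<open>a\<close>; hence the two integrals coincide.\<close>
  define c where "c = 1 / sqrt a"
  have c: "c > 0" "c\<^sup>2 = 1 / a" using assms by (simp_all add: c_def power_divide)
  have nd: "exp (- (a * x\<^sup>2) / 2) = sqrt (2 * pi / a) * normal_density 0 c x" for x
    using assms by (simp add: normal_density_def c)
  have "(\<integral>\<^sup>+x. ennreal (normal_density 0 c x) \<partial>lborel) = 1"
    using prob_space.emeasure_space_1[OF prob_space_normal_density[OF c(1), of 0]]
    by (simp add: emeasure_density)
  then show "(\<integral>\<^sup>+x. ennreal (exp (- (a * x\<^sup>2) / 2)) \<partial>lborel) = ennreal (sqrt (2 * pi / a))"
    unfolding nd using assms by (simp add: ennreal_mult nn_integral_cmult)
  have "has_bochner_integral lborel (\<lambda>x. normal_density 0 c x * x\<^sup>2) (c\<^sup>2)"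
    using normal_moment_even[OF c(1), of 0 1] by (simp add: power2_eq_square field_simps)
  then have m: "(\<integral>\<^sup>+x. ennreal (normal_density 0 c x * x\<^sup>2) \<partial>lborel) = ennreal (c\<^sup>2)"
    by (subst nn_integral_eq_integral) (auto simp: has_bochner_integral_iff)
  have eq: "a * x\<^sup>2 * exp (- (a * x\<^sup>2) / 2) = (a * sqrt (2 * pi / a)) * (normal_density 0 c x * x\<^sup>2)" for x
    unfolding nd by simp
  have nn: "0 \<le> a * sqrt (2 * pi / a)" using assms by simp
  have "(\<integral>\<^sup>+x. ennreal (a * x\<^sup>2 * exp (- (a * x\<^sup>2) / 2)) \<partial>lborel)
      = ennreal (a * sqrt (2 * pi / a)) * (\<integral>\<^sup>+x. ennreal (normal_density 0 c x * x\<^sup>2) \<partial>lborel)"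
    unfolding eq ennreal_mult'[OF nn] by (rule nn_integral_cmult) measurable
  also have "\<dots> = ennreal (sqrt (2 * pi / a))"
    unfolding m ennreal_mult'[OF nn, symmetric] using assms by (simp add: c(2))
  finally show "(\<integral>\<^sup>+x. ennreal (a * x\<^sup>2 * exp (- (a * x\<^sup>2) / 2)) \<partial>lborel) = ennreal (sqrt (2 * pi / a))" .
qed

text \<open>The product formula over \<open>Basis\<close> is reindexed by coordinates: the basis
  vectors are \<open>axis i 1\<close>, and \<open>ix\<close> recovers \<open>i\<close> from such a
  vector.\<close>

lemma nn_integral_lborel_cart_prod:
  fixes f :: "'k::finite \<Rightarrow> real \<Rightarrow> ennreal"
  assumes [measurable]: "\<And>i. f i \<in> borel_measurable borel"
  shows "(\<integral>\<^sup>+x. (\<Prod>i\<in>UNIV. f i (x $ i)) \<partial>(lborel :: (real^'k) measure)) = (\<Prod>i\<in>UNIV. \<integral>\<^sup>+x. f i x \<partial>lborel)"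
proof -
  define ix :: "real^'k \<Rightarrow> 'k" where "ix b = (THE i. b = axis i 1)" for b
  have ix: "ix (axis i 1) = i" for i
    unfolding ix_def by (rule the_equality) (auto simp: axis_eq_axis)
  have inj: "inj (\<lambda>i::'k. axis i (1::real))" by (auto simp: inj_on_def axis_eq_axis)
  have Basis: "(Basis :: (real^'k) set) = range (\<lambda>i. axis i 1)"
    by (auto simp: Basis_vec_def)
  have prod: "(\<Prod>b\<in>Basis. g b) = (\<Prod>i\<in>UNIV. g (axis i 1))" for g :: "real^'k \<Rightarrow> ennreal"
    unfolding Basis by (subst prod.reindex[OF inj]) simp
  have "(\<integral>\<^sup>+x. (\<Prod>b\<in>Basis. f (ix b) (x \<bullet> b)) \<partial>(lborel :: (real^'k) measure))
      = (\<Prod>b\<in>(Basis :: (real^'k) set). \<integral>\<^sup>+x. f (ix b) x \<partial>lborel)"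
    by (rule nn_integral_lborel_prod) auto
  then show ?thesis by (simp add: prod ix inner_axis)
qed

text \<open>The exponential splits into one-dimensional factors. Multiplying by one summand of
  \<open>q\<close> changes a single factor, and that factor keeps its integral; the
  \<open>CARD('k)\<close> summands therefore contribute equal amounts.\<close>

lemma nn_integral_gaussian_diag:
  fixes a :: "'k::finite \<Rightarrow> real"
  assumes a: "\<And>i. a i > 0"
  defines "q \<equiv> \<lambda>x::real^'k. \<Sum>i\<in>UNIV. a i * (x $ i)\<^sup>2"
  shows "(\<integral>\<^sup>+x. ennreal (exp (- q x / 2)) \<partial>lborel) = ennreal (\<Prod>i\<in>UNIV. sqrt (2 * pi / a i))"
    and "(\<integral>\<^sup>+x. ennreal (q x * exp (- q x / 2)) \<partial>lborel)
      = ennreal (CARD('k) * (\<Prod>i\<in>UNIV. sqrt (2 * pi / a i)))"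
proof -
  let ?e = "\<lambda>i t. exp (- (a i * t\<^sup>2) / 2)"
  have e: "exp (- q x / 2) = (\<Prod>i\<in>UNIV. ?e i (x $ i))" for x
    by (simp add: q_def exp_sum[symmetric] sum_negf sum_divide_distrib)
  have "(\<integral>\<^sup>+x. ennreal (exp (- q x / 2)) \<partial>lborel)
      = (\<integral>\<^sup>+x. (\<Prod>i\<in>UNIV. ennreal (?e i (x $ i))) \<partial>(lborel :: (real^'k) measure))"
    by (simp only: e prod_ennreal[OF exp_ge_zero])
  also have "\<dots> = (\<Prod>i\<in>UNIV. ennreal (sqrt (2 * pi / a i)))"
    by (rule trans[OF nn_integral_lborel_cart_prod], measurable,
        simp only: nn_integral_gaussian_1d(1)[OF a])
  also have "\<dots> = ennreal (\<Prod>i\<in>UNIV. sqrt (2 * pi / a i))"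
    using a by (simp add: prod_ennreal less_imp_le)
  finally show "(\<integral>\<^sup>+x. ennreal (exp (- q x / 2)) \<partial>lborel) = ennreal (\<Prod>i\<in>UNIV. sqrt (2 * pi / a i))" .
  \<comment> \<open>\<open>?g j i\<close> is the factor in coordinate \<open>i\<close> of the term
    coming from summand \<open>j\<close>: the coefficient \<open>a j * t^2\<close> is attached only
    where \<open>i = j\<close>, so each term stays a product over coordinates.\<close>
  let ?g = "\<lambda>j i t. (if i = j then a i * t\<^sup>2 else 1) * ?e i t"
  have qe: "q x * exp (- q x / 2) = (\<Sum>j\<in>UNIV. \<Prod>i\<in>UNIV. ?g j i (x $ i))" for x
  proof -
    have "(\<Prod>i\<in>UNIV. ?g j i (x $ i)) = a j * (x $ j)\<^sup>2 * exp (- q x / 2)" for j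
      unfolding e prod.distrib by simp
    then show ?thesis by (simp add: q_def sum_distrib_right)
  qed
  have g: "0 \<le> ?g j i t" for i j t using a[of i] by (auto simp: less_imp_le)
  have qe': "ennreal (q x * exp (- q x / 2)) = (\<Sum>j\<in>UNIV. \<Prod>i\<in>UNIV. ennreal (?g j i (x $ i)))" for x
    by (simp only: qe prod_ennreal[OF g] sum_ennreal[OF prod_nonneg, OF g])
  have "(\<integral>\<^sup>+x. ennreal (q x * exp (- q x / 2)) \<partial>lborel)
      = (\<integral>\<^sup>+x. (\<Sum>j\<in>UNIV. \<Prod>i\<in>UNIV. ennreal (?g j i (x $ i))) \<partial>(lborel :: (real^'k) measure))"
    by (simp only: qe')
  also have "\<dots> = (\<Sum>j\<in>UNIV. \<integral>\<^sup>+x. (\<Prod>i\<in>UNIV. ennreal (?g j i (x $ i))) \<partial>(lborel :: (real^'k) measure))"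
    by (rule nn_integral_sum) measurable
  also have "\<dots> = (\<Sum>j\<in>(UNIV::'k set). \<Prod>i\<in>UNIV. ennreal (sqrt (2 * pi / a i)))"
  proof (rule sum.cong[OF refl])
    fix j :: 'k
    have I: "(\<integral>\<^sup>+t. ennreal (?g j i t) \<partial>lborel) = ennreal (sqrt (2 * pi / a i))" for i
      using nn_integral_gaussian_1d[OF a[of i]] by (cases "i = j") simp_all
    show "(\<integral>\<^sup>+x. (\<Prod>i\<in>UNIV. ennreal (?g j i (x $ i))) \<partial>(lborel :: (real^'k) measure))
        = (\<Prod>i\<in>UNIV. ennreal (sqrt (2 * pi / a i)))"
      by (rule trans[OF nn_integral_lborel_cart_prod], measurable, simp only: I)
  qed
  also have "\<dots> = ennreal (CARD('k) * (\<Prod>i\<in>UNIV. sqrt (2 * pi / a i)))"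
    using a by (simp add: prod_ennreal less_imp_le ennreal_mult prod_nonneg ennreal_of_nat_eq_real_of_nat)
  finally show "(\<integral>\<^sup>+x. ennreal (q x * exp (- q x / 2)) \<partial>lborel)
      = ennreal (CARD('k) * (\<Prod>i\<in>UNIV. sqrt (2 * pi / a i)))" .
qed

text \<open>This is the normal density with mean \<open>m\<close> and covariance matrix inverse to
  \<open>A\<close>. With the precision as parameter, the matrix produced by completing the square
  can be inserted as it stands.\<close>

definition precision_density :: "real^'k^'k \<Rightarrow> real^'k \<Rightarrow> real^'k \<Rightarrow> real" where
  "precision_density A m x = sqrt (det A / (2 * pi) ^ CARD('k)) * exp (- ((x - m) \<bullet> (A *v (x - m))) / 2)"

lemma precision_density_pos:
  fixes A :: "real^'k^'k"
  assumes "det A > 0"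
  shows "precision_density A m x > 0"
  using assms by (simp add: precision_density_def)

lemma measurable_matrix_vector_mult [measurable (raw)]:
  fixes B :: "real^'a^'b"
  assumes "f \<in> borel_measurable N"
  shows "(\<lambda>z. B *v f z) \<in> borel_measurable N"
  by (rule measurable_compose[OF assms]) (intro borel_measurable_continuous_onI continuous_intros)

locale posdef_matrix =
  fixes A :: "real^'k^'k"
  assumes sym: "transpose A = A" and posdef: "x \<noteq> 0 \<Longrightarrow> x \<bullet> (A *v x) > 0"
begin

text \<open>In an orthonormal eigenbasis the coordinate map \<open>T\<close> is orthogonal and the
  quadratic form becomes diagonal with positive coefficients \<open>d i\<close>. Rotation invariance
  reduces both integrals to the diagonal case, and \<open>det A\<close> is the product of the
  \<open>d i\<close>.\<close>

lemma det_pos: "det A > 0"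
  and nn_integral_gaussian:
    "(\<integral>\<^sup>+x. ennreal (exp (- (x \<bullet> (A *v x)) / 2)) \<partial>lborel) = ennreal (sqrt ((2 * pi) ^ CARD('k) / det A))"
  and nn_integral_gaussian_quadratic:
    "(\<integral>\<^sup>+x. ennreal ((x \<bullet> (A *v x)) * exp (- (x \<bullet> (A *v x)) / 2)) \<partial>lborel)
      = ennreal (CARD('k) * sqrt ((2 * pi) ^ CARD('k) / det A))"
proof -
  obtain v :: "'k \<Rightarrow> real^'k" and d where on: "\<And>i j. v i \<bullet> v j = (if i = j then 1 else 0)"
    and ev: "\<And>i. A *v v i = d i *\<^sub>R v i"
    using symmetric_matrix_eigenbasis[OF sym] by blast
  have d: "d i > 0" for i
  proof -
    have "v i \<noteq> 0" using on[of i i] by auto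
    then have "0 < v i \<bullet> (A *v v i)" by (rule posdef)
    also have "\<dots> = d i" by (simp add: ev on)
    finally show ?thesis .
  qed
  have det: "det A = (\<Prod>i\<in>UNIV. d i)" by (rule det_eigenbasis[OF on ev])
  then show "det A > 0" using d by (simp add: prod_pos)
  have sq: "(\<Prod>i\<in>UNIV. sqrt (2 * pi / d i)) = sqrt ((2 * pi) ^ CARD('k) / det A)"
  proof -
    have "(\<Prod>i\<in>I. sqrt (f i)) = sqrt (\<Prod>i\<in>I. f i)" for I and f :: "'k \<Rightarrow> real"
      by (induction I rule: infinite_finite_induct) (simp_all add: real_sqrt_mult)
    then show ?thesis by (simp only: det prod_dividef prod_constant)
  qed
  define T where "T x = (\<chi> i. v i \<bullet> x)" for x
  have T: "orthogonal_transformation T"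
    unfolding orthogonal_transformation_def
  proof (intro conjI allI)
    show "linear T"
      by (rule linearI) (simp_all add: T_def vec_eq_iff inner_add_right)
    show "T x \<bullet> T y = x \<bullet> y" for x y
      unfolding orthonormal_expansion(2)[OF on, of x y] by (simp add: T_def inner_vec_def)
  qed
  have Avi: "v i \<bullet> (A *v x) = d i * (v i \<bullet> x)" for i x
    by (simp only: symmetric_matrix_inner[OF sym] ev inner_scaleR_left)
  have q: "x \<bullet> (A *v x) = (\<Sum>i\<in>UNIV. d i * (T x $ i)\<^sup>2)" for x
    unfolding orthonormal_expansion(2)[OF on, of x "A *v x"] Avi
    by (simp add: T_def power2_eq_square mult_ac)
  let ?q = "\<lambda>x::real^'k. \<Sum>i\<in>UNIV. d i * (x $ i)\<^sup>2"
  show "(\<integral>\<^sup>+x. ennreal (exp (- (x \<bullet> (A *v x)) / 2)) \<partial>lborel) = ennreal (sqrt ((2 * pi) ^ CARD('k) / det A))"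
    unfolding q sq[symmetric] nn_integral_gaussian_diag(1)[OF d, symmetric]
    by (rule nn_integral_lborel_orthogonal[OF T, of "\<lambda>x. ennreal (exp (- ?q x / 2))"]) measurable
  show "(\<integral>\<^sup>+x. ennreal ((x \<bullet> (A *v x)) * exp (- (x \<bullet> (A *v x)) / 2)) \<partial>lborel)
      = ennreal (CARD('k) * sqrt ((2 * pi) ^ CARD('k) / det A))"
    unfolding q sq[symmetric] nn_integral_gaussian_diag(2)[OF d, symmetric]
    by (rule nn_integral_lborel_orthogonal[OF T, of "\<lambda>x. ennreal (?q x * exp (- ?q x / 2))"]) measurable
qed

lemma nonneg: "0 \<le> x \<bullet> (A *v x)"
  using posdef[of x] by (cases "x = 0") auto

text \<open>Translation by \<open>m\<close> leads back to the centred integrals, and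
  \<open>?c\<close> is the reciprocal of the unnormalised mass. The expected quadratic form depends
  neither on \<open>A\<close> nor on \<open>m\<close>; this makes the prior and posterior forms
  cancel later.\<close>

lemma nn_integral_precision_density:
  "(\<integral>\<^sup>+x. ennreal (precision_density A m x) \<partial>lborel) = 1"
  and nn_integral_precision_density_quadratic:
  "(\<integral>\<^sup>+x. ennreal (precision_density A m x * ((x - m) \<bullet> (A *v (x - m)))) \<partial>lborel) = CARD('k)"
proof -
  let ?c = "sqrt (det A / (2 * pi) ^ CARD('k))"
  let ?q = "\<lambda>x. x \<bullet> (A *v x)"
  have c: "0 \<le> ?c" using det_pos by simp
  have cs: "?c * sqrt ((2 * pi) ^ CARD('k) / det A) = 1"
    using det_pos by (simp add: real_sqrt_mult[symmetric])
  have "(\<integral>\<^sup>+x. ennreal (precision_density A m x) \<partial>lborel)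
      = (\<integral>\<^sup>+x. ennreal (exp (- ?q (x + (- m)) / 2)) * ennreal ?c \<partial>lborel)"
    by (simp only: precision_density_def ennreal_mult'[OF c] diff_conv_add_uminus mult.commute[of _ "ennreal ?c"])
  also have "\<dots> = (\<integral>\<^sup>+x. ennreal (exp (- ?q x / 2)) * ennreal ?c \<partial>lborel)"
    by (rule nn_integral_lborel_translation[of "\<lambda>x. ennreal (exp (- ?q x / 2)) * ennreal ?c"]) measurable
  also have "\<dots> = ennreal (sqrt ((2 * pi) ^ CARD('k) / det A)) * ennreal ?c"
    unfolding nn_integral_gaussian[symmetric] by (rule nn_integral_multc) measurable
  also have "\<dots> = 1"
    unfolding mult.commute[of _ "ennreal ?c"] ennreal_mult'[OF c, symmetric] cs by simp
  finally show "(\<integral>\<^sup>+x. ennreal (precision_density A m x) \<partial>lborel) = 1" .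
  have "(\<integral>\<^sup>+x. ennreal (precision_density A m x * ((x - m) \<bullet> (A *v (x - m)))) \<partial>lborel)
      = (\<integral>\<^sup>+x. ennreal (?q (x + (- m)) * exp (- ?q (x + (- m)) / 2)) * ennreal ?c \<partial>lborel)"
  proof (rule nn_integral_cong)
    fix x
    have "precision_density A m x * ((x - m) \<bullet> (A *v (x - m)))
        = ?c * (?q (x + (- m)) * exp (- ?q (x + (- m)) / 2))"
      by (simp add: precision_density_def)
    then show "ennreal (precision_density A m x * ((x - m) \<bullet> (A *v (x - m))))
        = ennreal (?q (x + (- m)) * exp (- ?q (x + (- m)) / 2)) * ennreal ?c"
      by (simp only: ennreal_mult'[OF c] mult.commute[of _ "ennreal ?c"])
  qed
  also have "\<dots> = (\<integral>\<^sup>+x. ennreal (?q x * exp (- ?q x / 2)) * ennreal ?c \<partial>lborel)"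
    by (rule nn_integral_lborel_translation[of "\<lambda>x. ennreal (?q x * exp (- ?q x / 2)) * ennreal ?c"]) measurable
  also have "\<dots> = ennreal (CARD('k) * sqrt ((2 * pi) ^ CARD('k) / det A)) * ennreal ?c"
    unfolding nn_integral_gaussian_quadratic[symmetric] by (rule nn_integral_multc) measurable
  also have "\<dots> = ennreal (CARD('k) * (?c * sqrt ((2 * pi) ^ CARD('k) / det A)))"
    unfolding mult.commute[of _ "ennreal ?c"] ennreal_mult'[OF c, symmetric] by (simp add: mult_ac)
  also have "\<dots> = CARD('k)" unfolding cs by (simp add: ennreal_of_nat_eq_real_of_nat)
  finally show "(\<integral>\<^sup>+x. ennreal (precision_density A m x * ((x - m) \<bullet> (A *v (x - m)))) \<partial>lborel) = CARD('k)" .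
qed

end

section \<open>Divergence and conditional distributions\<close>

text \<open>Since \<open>f\<close> is positive, the second measure has density \<open>g / f\<close>
  relative to the first. This gives absolute continuity, and uniqueness of the Radon-Nikodym
  derivative identifies the entropy density. Integrability of the log ratio then selects the finite
  branch of \<open>KL\<close>.\<close>

lemma KL_density_density_eq:
  fixes f g :: "'a \<Rightarrow> real"
  assumes "sigma_finite_measure N"
    and [measurable]: "f \<in> borel_measurable N" "g \<in> borel_measurable N"
    and pos: "\<And>x. f x > 0" "\<And>x. g x > 0"
    and int: "has_bochner_integral N (\<lambda>x. g x * ln (g x / f x)) c"
  shows "KL (density N (\<lambda>x. ennreal (g x))) (density N (\<lambda>x. ennreal (f x))) = ereal c"
proof -
  interpret N: sigma_finite_measure N by fact
  let ?P = "density N (\<lambda>x. ennreal (f x))" and ?Q = "density N (\<lambda>x. ennreal (g x))"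
  have nonneg: "0 \<le> f x" "0 \<le> g x" "f x \<noteq> 0" "0 \<le> g x / f x" for x
    using pos[of x] by (simp_all add: less_imp_le)
  interpret P: sigma_finite_measure ?P
    by (subst N.sigma_finite_iff_density_finite) auto
  have PQ: "density ?P (\<lambda>x. ennreal (g x / f x)) = ?Q"
    using nonneg by (intro density_density_divide) auto
  have ac: "absolutely_continuous ?P ?Q"
    unfolding PQ[symmetric] by (intro absolutely_continuousI_density) simp
  have "AE x in ?P. ennreal (g x / f x) = RN_deriv ?P ?Q x"
    by (rule P.RN_deriv_unique[OF _ PQ]) simp
  then have "AE x in ?P. entropy_density (exp 1) ?P ?Q x = ln (g x / f x)"
  proof eventually_elim
    case (elim x)
    then show ?case
      using nonneg(4)[of x] by (simp add: entropy_density_def log_def flip: elim)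
  qed
  then have AE: "AE x in ?Q. entropy_density (exp 1) ?P ?Q x = ln (g x / f x)"
    by (rule absolutely_continuous_AE[rotated 2]) (use ac in auto)
  have "integrable ?Q (\<lambda>x. ln (g x / f x))"
    using int nonneg by (subst integrable_density) (auto simp: has_bochner_integral_iff)
  then have "integrable ?Q (entropy_density (exp 1) ?P ?Q)"
    by (rule integrable_cong_AE_imp) (use AE in \<open>auto elim!: eventually_mono\<close>)
  moreover have "KL_divergence (exp 1) ?P ?Q = c"
    using int nonneg by (subst N.KL_density_density) (auto simp: log_def has_bochner_integral_iff)
  ultimately show ?thesis
    using ac by (simp add: KL_def)
qed

text \<open>The event \<open>U \<in> A\<close> belongs to the sigma-algebra generated by
  \<open>U\<close>, so the conditional expectation of the indicator of \<open>V \<in> B\<close> may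
  be integrated over it in place of the indicator. Replacing it by the kernel and pushing forward
  along \<open>U\<close> gives the formula.\<close>

lemma emeasure_has_cond_distr:
  assumes "prob_space M" and [measurable]: "U \<in> M \<rightarrow>\<^sub>M S" "V \<in> M \<rightarrow>\<^sub>M T"
    and cond: "has_cond_distr M S T U V K"
    and [measurable]: "A \<in> sets S" "B \<in> sets T"
  shows "emeasure M {w\<in>space M. U w \<in> A \<and> V w \<in> B}
    = (\<integral>\<^sup>+u. indicator A u * emeasure (K u) B \<partial>distr M S U)"
proof -
  interpret prob_space M by fact
  let ?F = "vimage_algebra (space M) U S"
  have "subalgebra M ?F"
    unfolding subalgebra_def using measurable_space[OF assms(2)]
    by (auto simp: sets_vimage_algebra2 intro: measurable_sets)
  then interpret finite_measure_subalgebra M ?F by unfold_locales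
  have K [measurable]: "K \<in> S \<rightarrow>\<^sub>M prob_algebra T"
    using cond by (simp add: has_cond_distr_def)
  then have Ksub: "K \<in> S \<rightarrow>\<^sub>M subprob_algebra T" by (rule measurable_prob_algebraD)
  have Kmeas [measurable]: "(\<lambda>u. emeasure (K u) B) \<in> borel_measurable S"
    by (rule measurable_emeasure_kernel[OF Ksub]) measurable
  have KU: "emeasure (K (U w)) B = ennreal (measure (K (U w)) B)" if "w \<in> space M" for w
  proof -
    have "K (U w) \<in> space (prob_algebra T)"
      using measurable_space[OF K] measurable_space[OF assms(2) that] by blast
    then interpret Kw: prob_space "K (U w)" by (simp add: space_prob_algebra)
    show ?thesis by (rule Kw.emeasure_eq_measure)
  qed
  have [measurable]: "(\<lambda>w. measure (K (U w)) B) \<in> borel_measurable M"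
    unfolding measure_def by measurable
  let ?A = "U -` A \<inter> space M" and ?B = "V -` B \<inter> space M"
  have A: "?A \<in> sets ?F" by (rule in_vimage_algebra) fact
  have [measurable]: "?A \<in> sets M" "?B \<in> sets M" by measurable
  have AE: "AE w in M. real_cond_exp M ?F (indicator ?B) w = measure (K (U w)) B"
    using cond \<open>B \<in> sets T\<close> by (simp add: has_cond_distr_def)
  have iB: "integrable M (indicator ?B :: _ \<Rightarrow> real)"
    by (simp add: emeasure_eq_measure)
  have "{w\<in>space M. U w \<in> A \<and> V w \<in> B} = ?A \<inter> ?B" by auto
  then have "emeasure M {w\<in>space M. U w \<in> A \<and> V w \<in> B} = ennreal (measure M (?A \<inter> ?B))"
    by (simp add: emeasure_eq_measure)
  also have "measure M (?A \<inter> ?B) = (\<integral>w\<in>?A. indicator ?B w \<partial>M)"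
    by (simp add: set_lebesgue_integral_def indicator_inter_arith[symmetric])
  also have "\<dots> = (\<integral>w\<in>?A. real_cond_exp M ?F (indicator ?B) w \<partial>M)"
    by (rule real_cond_exp_intA[OF iB A])
  also have "\<dots> = (\<integral>w. indicator ?A w * measure (K (U w)) B \<partial>M)"
    unfolding set_lebesgue_integral_def using AE by (intro integral_cong_AE) auto
  also have "ennreal \<dots> = (\<integral>\<^sup>+w. ennreal (indicator ?A w * measure (K (U w)) B) \<partial>M)"
  proof (rule nn_integral_eq_integral[symmetric])
    have "integrable M (\<lambda>w. real_cond_exp M ?F (indicator ?B) w)"
      by (rule real_cond_exp_int(1)[OF iB])
    then have "integrable M (\<lambda>w. measure (K (U w)) B)"
      by (rule integrable_cong_AE_imp) (use AE in \<open>auto elim!: eventually_mono\<close>)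
    then show "integrable M (\<lambda>w. indicator ?A w * measure (K (U w)) B)"
      by (intro integrable_real_mult_indicator[unfolded mult.commute[of _ "indicator _ _"]]) auto
  qed auto
  also have "\<dots> = (\<integral>\<^sup>+w. indicator A (U w) * emeasure (K (U w)) B \<partial>M)"
    by (intro nn_integral_cong) (auto simp: KU indicator_def)
  also have "\<dots> = (\<integral>\<^sup>+u. indicator A u * emeasure (K u) B \<partial>distr M S U)"
    by (subst nn_integral_distr) measurable
  finally show ?thesis .
qed

text \<open>Measurable rectangles are an intersection-stable generator, and on them the two measures
  agree by the kernel formula and Tonelli.\<close>

lemma distr_pair_has_cond_distr:
  fixes f :: "'a::euclidean_space \<Rightarrow> real" and g :: "'a \<Rightarrow> 'b::euclidean_space \<Rightarrow> real"
  assumes "prob_space M" and [measurable]: "U \<in> M \<rightarrow>\<^sub>M borel" "V \<in> M \<rightarrow>\<^sub>M borel"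
    and cond: "has_cond_distr M borel borel U V (\<lambda>u. density lborel (\<lambda>v. ennreal (g u v)))"
    and U: "distr M borel U = density lborel (\<lambda>u. ennreal (f u))"
    and [measurable]: "f \<in> borel_measurable borel" "(\<lambda>(u, v). g u v) \<in> borel_measurable (borel \<Otimes>\<^sub>M borel)"
    and nonneg: "\<And>u. 0 \<le> f u"
  shows "distr M (borel \<Otimes>\<^sub>M borel) (\<lambda>w. (U w, V w))
    = density (lborel \<Otimes>\<^sub>M lborel) (\<lambda>(u, v). ennreal (f u * g u v))" (is "?L = ?R")
proof (rule measure_eqI_generator_eq)
  interpret prob_space M by fact
  let ?E = "{a \<times> b | a b. a \<in> sets (borel :: 'a measure) \<and> b \<in> sets (borel :: 'b measure)}"
  show "Int_stable ?E" by (rule Int_stable_pair_measure_generator)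
  show "?E \<subseteq> Pow UNIV" by simp
  show "sets ?L = sigma_sets UNIV ?E" "sets ?R = sigma_sets UNIV ?E"
    by (simp_all add: sets_pair_measure)
  \<comment> \<open>The whole space is a rectangle of finite measure, so a constant exhausting
    sequence suffices.\<close>
  show "range (\<lambda>_. UNIV) \<subseteq> ?E" by (auto intro!: exI[of _ UNIV])
  show "(\<Union>i::nat. UNIV) = UNIV" by simp
  show "emeasure ?L UNIV \<noteq> \<infinity>"
  proof -
    have "prob_space ?L" by (rule prob_space_distr) measurable
    then interpret L: prob_space ?L .
    show ?thesis by (simp add: L.emeasure_eq_measure)
  qed
  fix C assume "C \<in> ?E"
  then obtain A B where C: "C = A \<times> B" and [measurable]: "A \<in> sets borel" "B \<in> sets borel" by auto
  have "emeasure ?L C = emeasure M {w\<in>space M. U w \<in> A \<and> V w \<in> B}"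
    unfolding C by (subst emeasure_distr) (auto intro!: arg_cong[where f="emeasure M"])
  also have "\<dots> = (\<integral>\<^sup>+u. indicator A u * emeasure (density lborel (\<lambda>v. ennreal (g u v))) B \<partial>distr M borel U)"
    by (rule emeasure_has_cond_distr[OF \<open>prob_space M\<close> _ _ cond]) measurable
  also have "\<dots> = (\<integral>\<^sup>+u. indicator A u * (\<integral>\<^sup>+v. ennreal (g u v) * indicator B v \<partial>lborel) \<partial>distr M borel U)"
    by (intro nn_integral_cong) (subst emeasure_density; simp)
  also have "\<dots> = (\<integral>\<^sup>+u. ennreal (f u) * (indicator A u * (\<integral>\<^sup>+v. ennreal (g u v) * indicator B v \<partial>lborel)) \<partial>lborel)"
    unfolding U by (subst nn_integral_density) auto
  also have "\<dots> = (\<integral>\<^sup>+u. \<integral>\<^sup>+v. ennreal (f u * g u v) * indicator C (u, v) \<partial>lborel \<partial>lborel)"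
  proof (rule nn_integral_cong)
    fix u :: 'a
    have "ennreal (f u) * (indicator A u * (\<integral>\<^sup>+v. ennreal (g u v) * indicator B v \<partial>lborel))
        = (\<integral>\<^sup>+v. ennreal (f u) * (indicator A u * (ennreal (g u v) * indicator B v)) \<partial>lborel)"
      by (simp add: nn_integral_cmult)
    also have "\<dots> = (\<integral>\<^sup>+v. ennreal (f u * g u v) * indicator C (u, v) \<partial>lborel)"
      unfolding C by (intro nn_integral_cong) (simp add: ennreal_mult'[OF nonneg] indicator_times mult_ac)
    finally show "ennreal (f u) * (indicator A u * (\<integral>\<^sup>+v. ennreal (g u v) * indicator B v \<partial>lborel))
      = (\<integral>\<^sup>+v. ennreal (f u * g u v) * indicator C (u, v) \<partial>lborel)" .
  qed
  also have "\<dots> = (\<integral>\<^sup>+z. ennreal (f (fst z) * g (fst z) (snd z)) * indicator C z \<partial>(lborel \<Otimes>\<^sub>M lborel))"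
    unfolding C by (subst lborel.nn_integral_fst[symmetric]) (auto simp: split_beta')
  also have "\<dots> = emeasure ?R C"
    unfolding C by (subst emeasure_density) (auto simp: split_beta')
  finally show "emeasure ?L C = emeasure ?R C" .
qed

text \<open>Tonelli applies with an inner integral that is constant in the outer variable. The first
  form suits prior times likelihood, where \<open>y\<close> is integrated first; the swapped form
  suits evidence times posterior, where \<open>b\<close> is integrated first.\<close>

lemma has_bochner_integral_lborel_pair:
  fixes \<phi> :: "'a::euclidean_space \<Rightarrow> real" and G :: "'a \<Rightarrow> 'b::euclidean_space \<Rightarrow> real"
  assumes [measurable]: "\<phi> \<in> borel_measurable borel" "(\<lambda>(x, y). G x y) \<in> borel_measurable (borel \<Otimes>\<^sub>M borel)"
    and nonneg: "\<And>x. 0 \<le> \<phi> x" "\<And>x y. 0 \<le> G x y" "0 \<le> a" "0 \<le> c"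
    and int: "(\<integral>\<^sup>+x. ennreal (\<phi> x) \<partial>lborel) = ennreal a" "\<And>x. (\<integral>\<^sup>+y. ennreal (G x y) \<partial>lborel) = ennreal c"
  shows "has_bochner_integral (lborel \<Otimes>\<^sub>M lborel) (\<lambda>(x, y). \<phi> x * G x y) (a * c)"
    and "has_bochner_integral (lborel \<Otimes>\<^sub>M lborel) (\<lambda>(y, x). \<phi> x * G x y) (a * c)"
proof -
  have eq: "(\<integral>\<^sup>+x. \<integral>\<^sup>+y. ennreal (\<phi> x * G x y) \<partial>lborel \<partial>lborel) = ennreal (a * c)"
  proof -
    have "(\<integral>\<^sup>+y. ennreal (\<phi> x * G x y) \<partial>lborel) = ennreal (\<phi> x) * ennreal c" for x
      unfolding ennreal_mult'[OF nonneg(1)] int(2)[of x, symmetric] by (rule nn_integral_cmult) measurable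
    then show ?thesis
      by (simp add: nn_integral_multc int(1) ennreal_mult nonneg)
  qed
  show "has_bochner_integral (lborel \<Otimes>\<^sub>M lborel) (\<lambda>(x, y). \<phi> x * G x y) (a * c)"
  proof (rule has_bochner_integral_nn_integral)
    show "(\<integral>\<^sup>+z. ennreal (case z of (x, y) \<Rightarrow> \<phi> x * G x y) \<partial>(lborel \<Otimes>\<^sub>M lborel)) = ennreal (a * c)"
      unfolding eq[symmetric] by (subst lborel.nn_integral_fst[symmetric]) auto
  qed (use nonneg in auto)
  show "has_bochner_integral (lborel \<Otimes>\<^sub>M lborel) (\<lambda>(y, x). \<phi> x * G x y) (a * c)"
  proof (rule has_bochner_integral_nn_integral)
    have [measurable]: "(\<lambda>(y, x). G x y) \<in> borel_measurable (borel \<Otimes>\<^sub>M borel)"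
      using measurable_pair_swap[OF assms(2)] by (simp add: split_beta')
    show "(\<integral>\<^sup>+z. ennreal (case z of (y, x) \<Rightarrow> \<phi> x * G x y) \<partial>(lborel \<Otimes>\<^sub>M lborel)) = ennreal (a * c)"
      unfolding eq[symmetric] by (subst lborel_pair.nn_integral_snd[symmetric]) auto
    show "(\<lambda>(y, x). \<phi> x * G x y) \<in> borel_measurable (lborel \<Otimes>\<^sub>M lborel)"
      by measurable
  qed (use nonneg in auto)
qed

section \<open>The Gaussian linear model\<close>

lemma det_scaleR:
  fixes A :: "real^'k^'k"
  shows "det (c *\<^sub>R A) = c ^ CARD('k) * det A"
proof -
  have "c *\<^sub>R A = (c *\<^sub>R mat 1) ** A"
    by (simp only: scalar_matrix_assoc[symmetric] matrix_mul_lid)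
  moreover have "det (c *\<^sub>R mat 1 :: real^'k^'k) = c ^ CARD('k)"
    by (subst det_diagonal) (auto simp: mat_def)
  ultimately show ?thesis by (metis det_mul)
qed

lemma scaleR_mat_vector: "(c *\<^sub>R mat 1) *v x = c *\<^sub>R (x :: real^'k)"
  by (simp only: scaleR_matrix_vector_assoc[symmetric] matrix_vector_mul_lid)

lemma posdef_matrix_scaleR_mat:
  assumes "c > 0"
  shows "posdef_matrix (c *\<^sub>R mat 1 :: real^'k^'k)"
proof
  show "transpose (c *\<^sub>R mat 1 :: real^'k^'k) = c *\<^sub>R mat 1"
    by (auto simp: transpose_def mat_def vec_eq_iff)
  show "0 < x \<bullet> ((c *\<^sub>R mat 1) *v x)" if "x \<noteq> 0" for x :: "real^'k"
    using that assms by (simp add: scaleR_mat_vector)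
qed

lemma mv_normal_density_scaleR_mat:
  fixes m :: "real^'k"
  assumes c: "c > 0"
  shows "mv_normal_density m (c *\<^sub>R mat 1) x = precision_density ((1 / c) *\<^sub>R mat 1) m x"
proof -
  have 1: "(c *\<^sub>R mat 1 :: real^'k^'k) ** ((1 / c) *\<^sub>R mat 1) = mat 1"
    and 2: "((1 / c) *\<^sub>R mat 1 :: real^'k^'k) ** (c *\<^sub>R mat 1) = mat 1"
    using c by (simp_all add: scalar_matrix_assoc[symmetric] matrix_scalar_ac)
  \<comment> \<open>\<open>matrix_inv\<close> is defined by choice; uniqueness of two-sided inverses
    determines its value.\<close>
  have "matrix_inv (c *\<^sub>R mat 1 :: real^'k^'k) = (1 / c) *\<^sub>R mat 1"
    unfolding matrix_inv_def
  proof (rule some_equality)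
    fix B :: "real^'k^'k" assume "(c *\<^sub>R mat 1) ** B = mat 1 \<and> B ** (c *\<^sub>R mat 1) = mat 1"
    then show "B = (1 / c) *\<^sub>R mat 1"
      using 2 by (metis matrix_mul_assoc matrix_mul_lid matrix_mul_rid)
  qed (use 1 2 in blast)
  then show ?thesis
    using c by (simp add: mv_normal_density_def precision_density_def det_scaleR real_sqrt_divide
        real_sqrt_mult power_one_over field_simps)
qed

lemma measurable_precision_density [measurable (raw)]:
  fixes A :: "real^'k^'k"
  assumes [measurable]: "m \<in> borel_measurable N" "x \<in> borel_measurable N"
  shows "(\<lambda>z. precision_density A (m z) (x z)) \<in> borel_measurable N"
  unfolding precision_density_def by measurable

section \<open>Completing the square and Bayes' formula\<close>

locale gaussian_linear_model =
  fixes X :: "real^'p^'n" and \<sigma> \<tau> :: real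
  assumes sigma: "\<sigma> > 0" and tau: "\<tau> > 0"
begin

abbreviation "prior_prec \<equiv> (1 / \<tau>\<^sup>2) *\<^sub>R mat 1 :: real^'p^'p"
abbreviation "noise_prec \<equiv> (1 / \<sigma>\<^sup>2) *\<^sub>R mat 1 :: real^'n^'n"

definition post_prec :: "real^'p^'p" where
  "post_prec = (1 / \<tau>\<^sup>2) *\<^sub>R mat 1 + (1 / \<sigma>\<^sup>2) *\<^sub>R (transpose X ** X)"

text \<open>This is \<open>w(Y)\<close> of the opening comment, the minimiser in \<open>b\<close> of
  the joint quadratic exponent.\<close>

definition post_mean :: "real^'n \<Rightarrow> real^'p" where
  "post_mean y = matrix_inv post_prec *v ((1 / \<sigma>\<^sup>2) *\<^sub>R (transpose X *v y))"

text \<open>This is the part of the joint exponent left over once the square in \<open>b\<close> is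
  completed.\<close>

definition evidence_form :: "real^'n \<Rightarrow> real" where
  "evidence_form y = y \<bullet> (noise_prec *v y) - post_mean y \<bullet> (post_prec *v post_mean y)"

definition info_det :: real where
  "info_det = det (mat 1 + (\<tau>\<^sup>2 / \<sigma>\<^sup>2) *\<^sub>R (transpose X ** X))"

definition prior :: "real^'p \<Rightarrow> real" where
  "prior = precision_density prior_prec 0"

definition lik :: "real^'p \<Rightarrow> real^'n \<Rightarrow> real" where
  "lik b = precision_density noise_prec (X *v b)"

text \<open>The constant is the one that balances Bayes' formula, with
  \<open>det noise_prec / info_det\<close> in the role of the determinant of the precision of
  \<open>Y\<close>.\<close>

definition evidence :: "real^'n \<Rightarrow> real" where
  "evidence y = sqrt (1 / info_det * det noise_prec / (2 * pi) ^ CARD('n)) * exp (- evidence_form y / 2)"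

sublocale prior: posdef_matrix prior_prec
  using tau by (intro posdef_matrix_scaleR_mat) simp

sublocale noise: posdef_matrix noise_prec
  using sigma by (intro posdef_matrix_scaleR_mat) simp

lemma post_prec_quadratic:
  "x \<bullet> (post_prec *v y) = (1 / \<tau>\<^sup>2) * (x \<bullet> y) + (1 / \<sigma>\<^sup>2) * ((X *v x) \<bullet> (X *v y))"
  by (simp only: post_prec_def matrix_vector_mult_add_rdistrib scaleR_matrix_vector_assoc[symmetric]
      matrix_vector_mul_lid inner_add_right inner_scaleR_right inner_gram)

sublocale post: posdef_matrix post_prec
proof
  show "transpose post_prec = post_prec"
    using transpose_gram[of X] by (auto simp: post_prec_def transpose_def mat_def vec_eq_iff)
  show "0 < x \<bullet> (post_prec *v x)" if "x \<noteq> 0" for x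
    unfolding post_prec_quadratic using that tau by (intro add_pos_nonneg) auto
qed

text \<open>Pulling out the scalar \<open>1 / \<tau>\<^sup>2\<close> leaves the matrix of
  \<open>info_det\<close>, which is therefore the ratio of posterior to prior precision
  determinants.\<close>

lemma det_post_prec: "det post_prec = det prior_prec * info_det"
proof -
  have "post_prec = (1 / \<tau>\<^sup>2) *\<^sub>R (mat 1 + (\<tau>\<^sup>2 / \<sigma>\<^sup>2) *\<^sub>R (transpose X ** X))"
    using tau by (simp add: post_prec_def scaleR_add_right)
  then show ?thesis by (simp only: det_scaleR info_det_def det_I mult_1_right)
qed

lemma info_det_pos: "info_det > 0"
  using post.det_pos prior.det_pos by (simp add: det_post_prec zero_less_mult_iff)

lemma post_prec_post_mean: "post_prec *v post_mean y = (1 / \<sigma>\<^sup>2) *\<^sub>R (transpose X *v y)"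
proof -
  have "\<exists>B. post_prec ** B = mat 1 \<and> B ** post_prec = mat 1"
    using post.det_pos invertible_det_nz[of post_prec] by (auto simp: invertible_def)
  then have "post_prec ** matrix_inv post_prec = mat 1"
    unfolding matrix_inv_def by (metis (mono_tags, lifting) someI_ex)
  then show ?thesis
    by (simp only: post_mean_def matrix_vector_mul_assoc matrix_vector_mul_lid)
qed

text \<open>The quadratic terms in \<open>b\<close> agree by the choice of \<open>post_prec\<close>,
  the linear ones by \<open>post_prec_post_mean\<close>, and \<open>evidence_form\<close> collects
  the rest.\<close>

lemma complete_square:
  "b \<bullet> (prior_prec *v b) + (y - X *v b) \<bullet> (noise_prec *v (y - X *v b))
    = (b - post_mean y) \<bullet> (post_prec *v (b - post_mean y)) + evidence_form y"
proof -
  have 1: "b \<bullet> (post_prec *v post_mean y) = (1 / \<sigma>\<^sup>2) * ((X *v b) \<bullet> y)"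
    unfolding post_prec_post_mean inner_scaleR_right
    by (metis dot_lmul_matrix inner_commute transpose_matrix_vector)
  have 2: "post_mean y \<bullet> (post_prec *v b) = (1 / \<sigma>\<^sup>2) * ((X *v b) \<bullet> y)"
    unfolding symmetric_matrix_inner[OF post.sym, of "post_mean y" b]
    by (simp only: inner_commute[of "post_prec *v post_mean y" b] 1)
  have "(b - post_mean y) \<bullet> (post_prec *v (b - post_mean y))
      = b \<bullet> (post_prec *v b) - 2 * ((1 / \<sigma>\<^sup>2) * ((X *v b) \<bullet> y))
        + post_mean y \<bullet> (post_prec *v post_mean y)"
    by (simp only: matrix_vector_mult_diff_distrib inner_diff_left inner_diff_right 1 2)
  moreover have "(y - X *v b) \<bullet> (noise_prec *v (y - X *v b))
      = (1 / \<sigma>\<^sup>2) * (y \<bullet> y) - 2 * ((1 / \<sigma>\<^sup>2) * ((X *v b) \<bullet> y)) + (1 / \<sigma>\<^sup>2) * ((X *v b) \<bullet> (X *v b))"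
    unfolding scaleR_mat_vector inner_scaleR_right inner_diff_left inner_diff_right inner_commute[of y "X *v b"]
    by (simp only: right_diff_distrib)
  ultimately show ?thesis
    unfolding evidence_form_def post_prec_quadratic[of b b] scaleR_mat_vector inner_scaleR_right by linarith
qed

text \<open>The exponents match by \<open>complete_square\<close> and the normalising constants by
  \<open>det_post_prec\<close>.\<close>

lemma bayes: "prior b * lik b y = evidence y * precision_density post_prec (post_mean y) b"
proof -
  have s: "sqrt (det prior_prec / (2 * pi) ^ CARD('p)) * sqrt (det noise_prec / (2 * pi) ^ CARD('n))
     = sqrt (1 / info_det * det noise_prec / (2 * pi) ^ CARD('n)) * sqrt (det post_prec / (2 * pi) ^ CARD('p))"
    using info_det_pos unfolding det_post_prec by (simp add: real_sqrt_mult[symmetric] mult_ac)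
  have "prior b * lik b y
      = (sqrt (det prior_prec / (2 * pi) ^ CARD('p)) * sqrt (det noise_prec / (2 * pi) ^ CARD('n)))
        * exp (- (b \<bullet> (prior_prec *v b) + (y - X *v b) \<bullet> (noise_prec *v (y - X *v b))) / 2)"
    unfolding prior_def lik_def precision_density_def
    by (simp add: exp_add[symmetric] add_divide_distrib minus_add_distrib mult_ac)
  also have "\<dots> = evidence y * precision_density post_prec (post_mean y) b"
    unfolding s complete_square evidence_def precision_density_def
    by (simp add: exp_add[symmetric] add_divide_distrib minus_add_distrib mult_ac)
  finally show ?thesis .
qed

lemma prior_pos: "prior b > 0" and lik_pos: "lik b y > 0" and evidence_pos: "evidence y > 0"
  using info_det_pos noise.det_pos prior.det_pos
  by (simp_all add: prior_def lik_def evidence_def precision_density_pos)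

text \<open>The common constant \<open>?c\<close> cancels and leaves \<open>sqrt info_det\<close>,
  the source of the determinant in the mutual information.\<close>

lemma ln_lik_evidence:
  "ln (lik b y / evidence y)
    = 1/2 * ln info_det + evidence_form y / 2 - ((y - X *v b) \<bullet> (noise_prec *v (y - X *v b))) / 2"
proof -
  let ?q = "(y - X *v b) \<bullet> (noise_prec *v (y - X *v b))"
  let ?c = "sqrt (det noise_prec / (2 * pi) ^ CARD('n))"
  have c: "?c > 0" using noise.det_pos by simp
  have ratio: "k * u / (k / t * v) = t * (u / v)" if "k > 0" "t > 0" for k t u v :: real
    using that by simp
  have "evidence y = ?c / sqrt info_det * exp (- evidence_form y / 2)"
    by (simp add: evidence_def real_sqrt_mult real_sqrt_divide)
  moreover have "lik b y = ?c * exp (- ?q / 2)"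
    by (simp only: lik_def precision_density_def)
  ultimately have "lik b y / evidence y = sqrt info_det * (exp (- ?q / 2) / exp (- evidence_form y / 2))"
    using ratio[OF c] info_det_pos by (simp only: real_sqrt_gt_zero)
  also have "\<dots> = sqrt info_det * exp (evidence_form y / 2 - ?q / 2)"
    by (simp only: exp_diff[symmetric]) simp
  finally show ?thesis
    using info_det_pos by (simp add: ln_mult ln_sqrt)
qed

section \<open>Measurability and total masses\<close>

lemma measurable_gaussian_model [measurable]:
  "post_mean \<in> borel_measurable borel" "evidence \<in> borel_measurable borel"
  "prior \<in> borel_measurable borel" "(\<lambda>(b, y). lik b y) \<in> borel_measurable (borel \<Otimes>\<^sub>M borel)"
proof -
  show [measurable]: "post_mean \<in> borel_measurable borel"
    unfolding post_mean_def[abs_def] by measurable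
  show "evidence \<in> borel_measurable borel"
    unfolding evidence_def[abs_def] evidence_form_def by measurable
  show "prior \<in> borel_measurable borel"
    unfolding prior_def by measurable
  show "(\<lambda>(b, y). lik b y) \<in> borel_measurable (borel \<Otimes>\<^sub>M borel)"
    unfolding lik_def split_beta' by measurable
qed

lemma nn_integral_evidence_kernel:
  "(\<integral>\<^sup>+b. ennreal (prior b * lik b y) \<partial>lborel) = ennreal (evidence y)"
proof -
  have "(\<integral>\<^sup>+b. ennreal (prior b * lik b y) \<partial>lborel)
      = (\<integral>\<^sup>+b. ennreal (evidence y) * ennreal (precision_density post_prec (post_mean y) b) \<partial>lborel)"
    by (simp only: bayes ennreal_mult'[OF less_imp_le[OF evidence_pos]])
  also have "\<dots> = ennreal (evidence y) * (\<integral>\<^sup>+b. ennreal (precision_density post_prec (post_mean y) b) \<partial>lborel)"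
    by (rule nn_integral_cmult) measurable
  finally show ?thesis by (simp only: post.nn_integral_precision_density mult_1_right)
qed

lemma nn_integral_lik: "(\<integral>\<^sup>+y. ennreal (lik b y) \<partial>lborel) = 1"
  unfolding lik_def by (rule noise.nn_integral_precision_density)

lemma nn_integral_prior: "(\<integral>\<^sup>+b. ennreal (prior b) \<partial>lborel) = 1"
  unfolding prior_def by (rule prior.nn_integral_precision_density)

text \<open>Tonelli transfers the total mass 1 of prior times likelihood to its marginal in
  \<open>y\<close>.\<close>

lemma nn_integral_evidence: "(\<integral>\<^sup>+y. ennreal (evidence y) \<partial>lborel) = 1"
proof -
  have "(\<integral>\<^sup>+y. ennreal (evidence y) \<partial>lborel) = (\<integral>\<^sup>+y. \<integral>\<^sup>+b. ennreal (prior b * lik b y) \<partial>lborel \<partial>lborel)"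
    by (simp only: nn_integral_evidence_kernel)
  also have "\<dots> = (\<integral>\<^sup>+b. \<integral>\<^sup>+y. ennreal (prior b * lik b y) \<partial>lborel \<partial>lborel)"
    by (rule lborel_pair.Fubini') measurable
  also have "\<dots> = (\<integral>\<^sup>+b. ennreal (prior b) \<partial>lborel)"
  proof (rule nn_integral_cong)
    fix b
    have "(\<integral>\<^sup>+y. ennreal (prior b * lik b y) \<partial>lborel) = ennreal (prior b) * (\<integral>\<^sup>+y. ennreal (lik b y) \<partial>lborel)"
      unfolding ennreal_mult'[OF less_imp_le[OF prior_pos]] by (rule nn_integral_cmult) measurable
    then show "(\<integral>\<^sup>+y. ennreal (prior b * lik b y) \<partial>lborel) = ennreal (prior b)"
      by (simp only: nn_integral_lik mult_1_right)
  qed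
  finally show ?thesis by (simp only: nn_integral_prior)
qed

text \<open>The log ratio is \<open>1/2 * ln info_det\<close> plus half the prior form minus half
  the posterior form. The prior form is integrated against prior times likelihood, the posterior
  form against evidence times posterior. Both give \<open>CARD('p)\<close>, and only the constant
  survives.\<close>

lemma has_bochner_integral_log_ratio:
  "has_bochner_integral (lborel \<Otimes>\<^sub>M lborel)
    (\<lambda>(b, y). prior b * lik b y * ln (prior b * lik b y / (prior b * evidence y))) (1/2 * ln info_det)"
proof -
  let ?N = "lborel \<Otimes>\<^sub>M lborel :: ((real^'p) \<times> (real^'n)) measure"
  let ?Q0 = "\<lambda>b. b \<bullet> (prior_prec *v b)"
  let ?Q1 = "\<lambda>b y. (b - post_mean y) \<bullet> (post_prec *v (b - post_mean y))"
  let ?\<pi> = "\<lambda>y b. precision_density post_prec (post_mean y) b"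
  have I0: "has_bochner_integral ?N (\<lambda>(b, y). prior b * lik b y) (1 * 1)"
    by (rule has_bochner_integral_lborel_pair(1))
       (simp_all add: less_imp_le[OF prior_pos] less_imp_le[OF lik_pos] nn_integral_prior nn_integral_lik)
  have "(\<integral>\<^sup>+b. ennreal (prior b * ?Q0 b) \<partial>lborel) = ennreal (real CARD('p))"
    using prior.nn_integral_precision_density_quadratic[of 0]
    by (simp only: prior_def diff_0_right ennreal_of_nat_eq_real_of_nat)
  then have I1: "has_bochner_integral ?N (\<lambda>(b, y). prior b * ?Q0 b * lik b y) (real CARD('p) * 1)"
    by (intro has_bochner_integral_lborel_pair(1) mult_nonneg_nonneg less_imp_le[OF prior_pos]
          less_imp_le[OF lik_pos] prior.nonneg)
       (simp_all add: nn_integral_lik)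
  have "(\<integral>\<^sup>+b. ennreal (?\<pi> y b * ?Q1 b y) \<partial>lborel) = ennreal (real CARD('p))" for y
    by (simp only: post.nn_integral_precision_density_quadratic ennreal_of_nat_eq_real_of_nat)
  then have I2: "has_bochner_integral ?N (\<lambda>(b, y). evidence y * (?\<pi> y b * ?Q1 b y)) (1 * real CARD('p))"
    by (intro has_bochner_integral_lborel_pair(2)[where \<phi>=evidence] mult_nonneg_nonneg less_imp_le[OF evidence_pos]
          less_imp_le[OF precision_density_pos[OF post.det_pos]] post.nonneg)
       (simp_all add: nn_integral_evidence split_beta')
  have "prior b * lik b y * ln (prior b * lik b y / (prior b * evidence y))
      = 1/2 * ln info_det * (prior b * lik b y) + 1/2 * (prior b * ?Q0 b * lik b y)
        - 1/2 * (evidence y * (?\<pi> y b * ?Q1 b y))" for b y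
  proof -
    have "ln (prior b * lik b y / (prior b * evidence y)) = ln (lik b y / evidence y)"
      using prior_pos[of b] by simp
    \<comment> \<open>By \<open>complete_square\<close>, the evidence form minus the noise form
      equals \<open>?Q0 b - ?Q1 b y\<close>.\<close>
    also have "\<dots> = 1/2 * ln info_det + 1/2 * ?Q0 b - 1/2 * ?Q1 b y"
      using complete_square[of b y] unfolding ln_lik_evidence by linarith
    finally have E: "ln (prior b * lik b y / (prior b * evidence y))
      = 1/2 * ln info_det + 1/2 * ?Q0 b - 1/2 * ?Q1 b y" .
    have "prior b * lik b y * ln (prior b * lik b y / (prior b * evidence y))
      = 1/2 * ln info_det * (prior b * lik b y) + 1/2 * (prior b * ?Q0 b * lik b y)
        - 1/2 * (prior b * lik b y * ?Q1 b y)"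
      unfolding E by (simp only: right_diff_distrib distrib_left mult_ac)
    \<comment> \<open>Bayes' formula turns the weight of \<open>?Q1\<close> into evidence times
      posterior, as in \<open>I2\<close>.\<close>
    then show ?thesis unfolding bayes by (simp only: mult.assoc)
  qed
  moreover have "has_bochner_integral ?N (\<lambda>z. 1/2 * ln info_det * (case z of (b, y) \<Rightarrow> prior b * lik b y)
      + 1/2 * (case z of (b, y) \<Rightarrow> prior b * ?Q0 b * lik b y)
      - 1/2 * (case z of (b, y) \<Rightarrow> evidence y * (?\<pi> y b * ?Q1 b y)))
    (1/2 * ln info_det * (1 * 1) + 1/2 * (real CARD('p) * 1) - 1/2 * (1 * real CARD('p)))"
    by (intro has_bochner_integral_diff has_bochner_integral_add has_bochner_integral_mult_right I0 I1 I2)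
  ultimately show ?thesis by (simp add: split_beta')
qed

section \<open>Mutual information and effective dimension\<close>

theorem mutual_info_gaussian_linear_model:
  fixes M :: "'w measure"
  assumes "prob_space M" and [measurable]: "\<beta> \<in> M \<rightarrow>\<^sub>M borel" "Y \<in> M \<rightarrow>\<^sub>M borel"
    and prior: "distr M borel \<beta> = mv_normal 0 (\<tau>\<^sup>2 *\<^sub>R mat 1)"
    and lik: "has_cond_distr M borel borel \<beta> Y (\<lambda>b. mv_normal (X *v b) (\<sigma>\<^sup>2 *\<^sub>R mat 1))"
  shows "mutual_info M borel borel \<beta> Y = ereal (1/2 * ln info_det)"
proof -
  interpret prob_space M by fact
  let ?N = "lborel \<Otimes>\<^sub>M lborel :: ((real^'p) \<times> (real^'n)) measure"
  have d\<beta>: "distr M borel \<beta> = density lborel (\<lambda>b. ennreal (prior b))"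
    using tau by (simp add: prior mv_normal_def mv_normal_density_scaleR_mat prior_def)
  have cond: "has_cond_distr M borel borel \<beta> Y (\<lambda>b. density lborel (\<lambda>y. ennreal (lik b y)))"
    using lik sigma by (simp add: mv_normal_def mv_normal_density_scaleR_mat lik_def)
  have joint: "distr M (borel \<Otimes>\<^sub>M borel) (\<lambda>w. (\<beta> w, Y w)) = density ?N (\<lambda>(b, y). ennreal (prior b * lik b y))"
    by (rule distr_pair_has_cond_distr[OF \<open>prob_space M\<close> _ _ cond d\<beta>]) (auto simp: less_imp_le[OF prior_pos])
  \<comment> \<open>The law of \<open>Y\<close> is the second marginal of the joint law, so its
    density arises by integrating \<open>b\<close> out.\<close>
  have dY: "distr M borel Y = density lborel (\<lambda>y. ennreal (evidence y))"
  proof (rule measure_eqI)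
    fix B assume "B \<in> sets (distr M borel Y)"
    then have [measurable]: "B \<in> sets borel" by simp
    have "emeasure (distr M borel Y) B = emeasure (distr M (borel \<Otimes>\<^sub>M borel) (\<lambda>w. (\<beta> w, Y w))) (UNIV \<times> B)"
      by (simp add: emeasure_distr) (auto intro!: arg_cong[where f="emeasure M"])
    also have "\<dots> = (\<integral>\<^sup>+z. (case z of (b, y) \<Rightarrow> ennreal (prior b * lik b y)) * indicator (UNIV \<times> B) z \<partial>?N)"
      unfolding joint by (rule emeasure_density) measurable
    also have "\<dots> = (\<integral>\<^sup>+y. \<integral>\<^sup>+b. ennreal (prior b * lik b y) * indicator B y \<partial>lborel \<partial>lborel)"
      by (subst lborel_pair.nn_integral_snd[symmetric]) (auto simp: indicator_times split_beta')
    also have "\<dots> = (\<integral>\<^sup>+y. ennreal (evidence y) * indicator B y \<partial>lborel)"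
      by (simp add: nn_integral_multc nn_integral_evidence_kernel)
    also have "\<dots> = emeasure (density lborel (\<lambda>y. ennreal (evidence y))) B"
      by (simp add: emeasure_density)
    finally show "emeasure (distr M borel Y) B = emeasure (density lborel (\<lambda>y. ennreal (evidence y))) B" .
  qed simp
  \<comment> \<open>This supplies the sigma-finiteness used in forming the product of the two
    densities.\<close>
  have "prob_space (distr M borel Y)" by (rule prob_space_distr) measurable
  then interpret Y: prob_space "density lborel (\<lambda>y. ennreal (evidence y))" unfolding dY .
  have prod: "distr M borel \<beta> \<Otimes>\<^sub>M distr M borel Y = density ?N (\<lambda>z. ennreal (prior (fst z) * evidence (snd z)))"
    unfolding d\<beta> dY
    by (subst pair_measure_density)
       (auto simp: split_beta' ennreal_mult'[OF less_imp_le[OF prior_pos]] intro: Y.sigma_finite_measure_axioms lborel.sigma_finite_measure_axioms)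
  have "KL (density ?N (\<lambda>z. ennreal (prior (fst z) * lik (fst z) (snd z))))
      (density ?N (\<lambda>z. ennreal (prior (fst z) * evidence (snd z)))) = ereal (1/2 * ln info_det)"
  proof (rule KL_density_density_eq)
    show "sigma_finite_measure ?N" by (rule lborel_pair.sigma_finite_measure_axioms)
    show "has_bochner_integral ?N (\<lambda>z. prior (fst z) * lik (fst z) (snd z)
        * ln (prior (fst z) * lik (fst z) (snd z) / (prior (fst z) * evidence (snd z)))) (1/2 * ln info_det)"
      using has_bochner_integral_log_ratio by (simp only: split_beta')
  qed (auto simp: prior_pos lik_pos evidence_pos)
  then show ?thesis
    by (simp only: mutual_info_def joint prod split_beta')
qed

end

theorem proposition5:
  fixes X :: "real^'p^'n"
    and r :: nat and s :: "nat \<Rightarrow> real"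
    and \<sigma> \<tau> lam :: real
    and M :: "'w measure"
    and \<beta> :: "'w \<Rightarrow> real^'p" and Y :: "'w \<Rightarrow> real^'n"
  assumes "rank X = r"
    and "nonzero_singular_values X r s"
    and "\<sigma> > 0" and "\<tau> > 0" and "lam = \<tau>\<^sup>2 / \<sigma>\<^sup>2"
    and "prob_space M"
    and "\<beta> \<in> M \<rightarrow>\<^sub>M borel" and "Y \<in> M \<rightarrow>\<^sub>M borel"
    and "distr M borel \<beta> = mv_normal 0 (\<tau>\<^sup>2 *\<^sub>R mat 1)"
    and "has_cond_distr M borel borel \<beta> Y (\<lambda>b. mv_normal (X *v b) (\<sigma>\<^sup>2 *\<^sub>R mat 1))"
  shows "mutual_info M borel borel \<beta> Y = ereal (1/2 * ln (det (mat 1 + lam *\<^sub>R (transpose X ** X))))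
    \<and> 1/2 * ln (det (mat 1 + lam *\<^sub>R (transpose X ** X))) = 1/2 * (\<Sum>j=1..r. ln (1 + lam * (s j)\<^sup>2))
    \<and> (CARD('n) \<ge> 3 \<longrightarrow>
        bayes_eff_dim M borel borel \<beta> Y CARD('n)
          = ereal (1 / ln (real CARD('n)) * (\<Sum>j=1..r. ln (1 + lam * (s j)\<^sup>2))))"
proof -
  interpret gaussian_linear_model X \<sigma> \<tau>
    using assms(3,4) by unfold_locales
  let ?d = "det (mat 1 + lam *\<^sub>R (transpose X ** X))"
  let ?S = "\<Sum>j=1..r. ln (1 + lam * (s j)\<^sup>2)"
  have mi: "mutual_info M borel borel \<beta> Y = ereal (1/2 * ln ?d)"
    using mutual_info_gaussian_linear_model[OF assms(6-10)] unfolding info_det_def assms(5) .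
  have ln: "ln ?d = ?S"
    using assms(5) by (intro ln_det_singular_values[OF assms(2)]) simp
  have "bayes_eff_dim M borel borel \<beta> Y CARD('n) = ereal (1 / ln (real CARD('n)) * ?S)" if "CARD('n) \<ge> 3"
  proof -
    \<comment> \<open>A positive denominator makes the extended-real quotient an ordinary one; the
      factor 2 of the definition cancels the \<open>1/2\<close>.\<close>
    have "ln (real CARD('n)) > 0" using that by simp
    then show ?thesis
      unfolding bayes_eff_dim_def mi ln by simp
  qed
  with mi ln show ?thesis by simp
qed

end
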